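(* Let $\gamma>0$, let $\mathbf u=[u_0,(\mathbf u_\#)^\top]^\top\in\mathbb R^{n+1}$ with $u_0>0$, write $\overline{\mathbf u}_\#=\mathbf u_\#/u_0$, and let $\boldsymbol\beta^\gamma_{\overline{\mathbf u}_\#}=\operatorname{argmin}_{\boldsymbol\beta\in\mathbb R^n}\hat\phi^\gamma(\boldsymbol\beta;\overline{\mathbf u}_\#)$. Then $$\widetilde{\mathbf u}^\gamma=\mathbf u-u_0\gamma\,[0,(\boldsymbol\beta^\gamma_{\overline{\mathbf u}_\#})^\top]^\top .$$ Further, suppose $M>0$ is finite and $\|\boldsymbol\beta^\gamma_{\overline{\mathbf u}_\#}\|<M$. Then $$\|\widetilde{\mathbf u}^\gamma-\mathbf u\|=u_0\gamma\,\|\boldsymbol\beta^\gamma_{\overline{\mathbf u}_\#}\|\le u_0\gamma M,$$ and $$\|\mathbf u^\gamma-\mathbf u\|\le u_0\gamma M+\big(1-\exp(-\tfrac\gamma2M^2)\big)\|\widetilde{\mathbf u}^\gamma\|\le u_0\left(\gamma M+(n+1)\Big(\frac{n+1}{|\mathbb S^2|}\Big)^{1/2}\Big(1-\exp\big(-\tfrac\gamma2M^2\big)\Big)\right),$$ where $|\mathbb S^2|$ is the measure of the unit sphere.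
   Context: Write $\langle g\rangle=\int_{\mathbb S^2}g(\mathbf v)\,d\mathbf v$, where $\mathbb S^2$ is the unit sphere in $\mathbb R^3$; $\|\cdot\|$ is the Euclidean norm. Let $N\ge1$ and let $\mathbf m=[m_0,\mathbf m_\#^\top]^\top:\mathbb S^2\to\mathbb R^{n+1}$, $n+1=(N+1)^2$, be the vector of real spherical harmonics up to degree $N$, orthonormal in $L^2(\mathbb S^2)$ and ordered by degree; $m_0=|\mathbb S^2|^{-1/2}$ is the constant degree-zero harmonic and $\mathbf m_\#$ collects the remaining $n$ entries. For $\mathbf y=(y_0,\dots,y_n)^\top\in\mathbb R^{n+1}$ set $\mathbf y_\#=(y_1,\dots,y_n)^\top$. For $u_0>0$, $\gamma>0$, define $$\phi^\gamma(\boldsymbol\alpha;\mathbf u)=\langle\exp(\boldsymbol\alpha\cdot\mathbf m)\rangle-\boldsymbol\alpha\cdot\mathbf u+\frac{u_0\gamma}{2}\|\boldsymbol\alpha_\#\|^2,\qquad \boldsymbol\alpha\in\mathbb R^{n+1},$$ and let $\boldsymbol\alpha^\gamma_{\mathbf u}$ be its minimizer over $\mathbb R^{n+1}$. The partially regularized entropy is $h^\gamma(\mathbf u)$, the optimal value of $\min_{g\ge0}\langle g\log g-g\rangle+\frac{1}{2u_0\gamma}\|\langle\mathbf m_\# g\rangle-\mathbf u_\#\|^2$ subject to $u_0=\langle m_0g\rangle$ (over nonnegative $g$ on $\mathbb S^2$ with finite moments $\langle \mathbf m g\rangle$); by (known) strong duality $h^\gamma(\mathbf u)=-\phi^\gamma(\boldsymbol\alpha^\gamma_{\mathbf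 u};\mathbf u)$. Let $\mathbf g^\gamma_{\mathbf u}=\nabla_{\mathbf u}h^\gamma(\mathbf u)$. The two ansatz densities are $$\widetilde f^\gamma_{\mathbf u}=\exp(\boldsymbol\alpha^\gamma_{\mathbf u}\cdot\mathbf m),\qquad f^\gamma_{\mathbf u}=\exp(\mathbf g^\gamma_{\mathbf u}\cdot\mathbf m),$$ with associated moments $\widetilde{\mathbf u}^\gamma=\langle\mathbf m\widetilde f^\gamma_{\mathbf u}\rangle$ and $\mathbf u^\gamma=\langle\mathbf m f^\gamma_{\mathbf u}\rangle$. For $\boldsymbol\beta\in\mathbb R^n$ let $\vartheta(\boldsymbol\beta)=-\frac1{m_0}\big(\log m_0+\log\langle\exp(\boldsymbol\beta\cdot\mathbf m_\#)\rangle\big)$, and for $\mathbf w\in\mathbb R^n$ let $\hat\phi^\gamma(\boldsymbol\beta;\mathbf w)=\phi^\gamma\big([\vartheta(\boldsymbol\beta),\boldsymbol\beta^\top]^\top;[1,\mathbf w^\top]^\top\big)$. *)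

theory Defs
  imports "HOL-Analysis.Analysis"
begin

text \<open>
  The surface measure of a Borel set \<open>A\<close> of the sphere is three times the volume of the cone
  \<open>{t v | 0 < t < 1, v \<in> A}\<close>; equivalently, it is the measure for which integration in polar
  coordinates, \<open>dx = t\<^sup>2 dt dv\<close>, holds.
\<close>

definition S2 :: "(real^3) measure" where
  "S2 = scale_measure 3
     (distr (restrict_space lborel (ball 0 1 - {0})) (restrict_space borel (sphere 0 1))
       (\<lambda>x. x /\<^sub>R norm x))"

abbreviation area_S2 :: real where
  "area_S2 \<equiv> measure S2 (space S2)"

lemma space_S2: "space S2 = sphere 0 1"
  by (simp add: S2_def space_scale_measure space_restrict_space)

lemma area_S2_eq: "area_S2 = 4 * pi"
proof -
  let ?M = "restrict_space lborel (ball (0::real^3) 1 - {0})"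
  let ?N = "restrict_space borel (sphere (0::real^3) 1)"
  have meas: "(\<lambda>x. x /\<^sub>R norm x) \<in> measurable ?M ?N"
    by (intro measurable_restrict_space3) (auto simp: norm_divide)
  have "measure S2 (space S2) = 3 * measure (distr ?M ?N (\<lambda>x. x /\<^sub>R norm x)) (space ?N)"
    by (simp add: S2_def measure_def space_scale_measure enn2real_mult)
  also have "measure (distr ?M ?N (\<lambda>x. x /\<^sub>R norm x)) (space ?N) = measure ?M (space ?M)"
    using measurable_space[OF meas] sets.top[of ?N]
    by (subst measure_distr[OF meas]) (auto intro!: arg_cong[where f = "measure ?M"])
  also have "measure ?M (space ?M) = measure lborel (ball (0::real^3) 1 - {0})"
    by (simp add: space_restrict_space measure_restrict_space)
  also have "\<dots> = measure lborel (ball (0::real^3) 1)"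
    by (rule measure_Diff_null_set) (auto simp: null_sets_def)
  also have "\<dots> = 4 / 3 * pi"
    using content_ball[of 1 "0::real^3"] by (simp add: unit_ball_vol_3)
  finally show ?thesis by simp
qed

definition laplacian :: "('a::euclidean_space \<Rightarrow> real) \<Rightarrow> 'a \<Rightarrow> real" where
  "laplacian p x = (\<Sum>b\<in>Basis. (deriv ^^ 2) (\<lambda>t. p (x + t *\<^sub>R b)) 0)"

definition spherical_harmonic :: "nat \<Rightarrow> (real^3 \<Rightarrow> real) \<Rightarrow> bool" where
  "spherical_harmonic l Y \<longleftrightarrow>
     (\<exists>p. real_polynomial_function p \<and> (\<forall>c x. p (c *\<^sub>R x) = c ^ l * p x) \<and>
          (\<forall>x. laplacian p x = 0) \<and> (\<forall>v\<in>sphere 0 1. Y v = p v))"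

text \<open>
  \<open>Y 0, \<dots>, Y ((N + 1)\<^sup>2 - 1)\<close> is an orthonormal family of spherical harmonics up to degree
  \<open>N\<close>, ordered by degree: those of degree \<open>l\<close> occupy the \<open>2 l + 1\<close> positions
  \<open>l\<^sup>2 \<le> i < (l + 1)\<^sup>2\<close>.
\<close>

definition real_spherical_harmonics :: "nat \<Rightarrow> (nat \<Rightarrow> real^3 \<Rightarrow> real) \<Rightarrow> bool" where
  "real_spherical_harmonics N Y \<longleftrightarrow>
     (\<forall>v\<in>sphere 0 1. Y 0 v = 1 / sqrt area_S2) \<and>
     (\<forall>l\<le>N. \<forall>i\<in>{l\<^sup>2..<(l + 1)\<^sup>2}. spherical_harmonic l (Y i)) \<and>
     (\<forall>i<(N + 1)\<^sup>2. \<forall>j<(N + 1)\<^sup>2.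
        (LINT v|S2. Y i v * Y j v) = (if i = j then 1 else 0))"

text \<open>
  Vectors \<open>y = (y\<^sub>0, y\<^sub>1, \<dots>, y\<^sub>n)\<close> are elements of \<open>real \<times> (real^'n)\<close> with \<open>n = CARD('n)\<close>: then
  \<open>y\<^sub>0 = fst y\<close>, the vector of the remaining entries is \<open>snd y\<close>, and the inner product and the
  norm of the product type are the Euclidean ones. The bijection \<open>idx\<close> from \<open>'n\<close> to
  \<open>{1..n}\<close> gives the position of each of the remaining entries.
\<close>

definition harmonics_vector ::
    "(nat \<Rightarrow> real^3 \<Rightarrow> real) \<Rightarrow> ('n \<Rightarrow> nat) \<Rightarrow> real^3 \<Rightarrow> real \<times> (real^'n)" where
  "harmonics_vector Y idx v = (Y 0 v, \<chi> k. Y (idx k) v)"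

definition phi :: "(real^3 \<Rightarrow> real \<times> (real^'n)) \<Rightarrow> real \<Rightarrow> real \<times> (real^'n) \<Rightarrow> real \<times> (real^'n) \<Rightarrow> real"
  where
  "phi m \<gamma> u \<alpha> =
     (LINT v|S2. exp (\<alpha> \<bullet> m v)) - \<alpha> \<bullet> u + fst u * \<gamma> / 2 * (norm (snd \<alpha>))\<^sup>2"

definition alpha_opt :: "(real^3 \<Rightarrow> real \<times> (real^'n)) \<Rightarrow> real \<Rightarrow> real \<times> (real^'n) \<Rightarrow> real \<times> (real^'n)"
  where
  "alpha_opt m \<gamma> u = arg_min (phi m \<gamma> u) (\<lambda>_. True)"

text \<open>
  In the primal problem the integral of \<open>g log g - g\<close> is well defined in \<open>(-\<infinity>, \<infinity>]\<close>, as the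
  integrand is at least \<open>-1\<close>. Densities for which it is \<open>\<infinity>\<close> are left out; they do not affect
  the optimal value. The library's \<open>ln 0 = 0\<close> agrees with the convention \<open>0 log 0 = 0\<close>.
\<close>

definition feasible_densities ::
    "(real^3 \<Rightarrow> real \<times> (real^'n)) \<Rightarrow> real \<times> (real^'n) \<Rightarrow> (real^3 \<Rightarrow> real) set" where
  "feasible_densities m u =
     {g. g \<in> borel_measurable S2 \<and> (\<forall>v\<in>sphere 0 1. 0 \<le> g v) \<and>
         integrable S2 (\<lambda>v. g v *\<^sub>R m v) \<and>
         integrable S2 (\<lambda>v. g v * ln (g v) - g v) \<and>
         fst u = (LINT v|S2. fst (m v) * g v)}"

definition entropy :: "(real^3 \<Rightarrow> real \<times> (real^'n)) \<Rightarrow> real \<Rightarrow> real \<times> (real^'n) \<Rightarrow> real" where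
  "entropy m \<gamma> u =
     (INF g\<in>feasible_densities m u.
        (LINT v|S2. g v * ln (g v) - g v) +
        1 / (2 * fst u * \<gamma>) * (norm ((LINT v|S2. g v *\<^sub>R snd (m v)) - snd u))\<^sup>2)"

definition entropy_grad :: "(real^3 \<Rightarrow> real \<times> (real^'n)) \<Rightarrow> real \<Rightarrow> real \<times> (real^'n) \<Rightarrow> real \<times> (real^'n)"
  where
  "entropy_grad m \<gamma> u = (THE D. GDERIV (entropy m \<gamma>) u :> D)"

definition ansatz :: "(real^3 \<Rightarrow> real \<times> (real^'n)) \<Rightarrow> real \<times> (real^'n) \<Rightarrow> real^3 \<Rightarrow> real" where
  "ansatz m \<alpha> v = exp (\<alpha> \<bullet> m v)"

definition moments :: "(real^3 \<Rightarrow> real \<times> (real^'n)) \<Rightarrow> (real^3 \<Rightarrow> real) \<Rightarrow> real \<times> (real^'n)" where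
  "moments m f = (LINT v|S2. f v *\<^sub>R m v)"

definition u_tilde :: "(real^3 \<Rightarrow> real \<times> (real^'n)) \<Rightarrow> real \<Rightarrow> real \<times> (real^'n) \<Rightarrow> real \<times> (real^'n)"
  where
  "u_tilde m \<gamma> u = moments m (ansatz m (alpha_opt m \<gamma> u))"

definition u_gamma :: "(real^3 \<Rightarrow> real \<times> (real^'n)) \<Rightarrow> real \<Rightarrow> real \<times> (real^'n) \<Rightarrow> real \<times> (real^'n)"
  where
  "u_gamma m \<gamma> u = moments m (ansatz m (entropy_grad m \<gamma> u))"

definition theta :: "(real^3 \<Rightarrow> real \<times> (real^'n)) \<Rightarrow> real^'n \<Rightarrow> real" where
  "theta m \<beta> =
     (let m\<^sub>0 = 1 / sqrt area_S2
      in - (1 / m\<^sub>0) * (ln m\<^sub>0 + ln (LINT v|S2. exp (\<beta> \<bullet> snd (m v)))))"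

definition phi_hat :: "(real^3 \<Rightarrow> real \<times> (real^'n)) \<Rightarrow> real \<Rightarrow> real^'n \<Rightarrow> real^'n \<Rightarrow> real" where
  "phi_hat m \<gamma> w \<beta> = phi m \<gamma> (1, w) (theta m \<beta>, \<beta>)"

definition beta_opt :: "(real^3 \<Rightarrow> real \<times> (real^'n)) \<Rightarrow> real \<Rightarrow> real^'n \<Rightarrow> real^'n" where
  "beta_opt m \<gamma> w = arg_min (phi_hat m \<gamma> w) (\<lambda>_. True)"

end

theory Submission
  imports Defs "HOL-Computational_Algebra.Polynomial"
begin

text \<open>
  The regularized dual function splits off its zeroth variable: for fixed \<open>\<beta>\<close> the function
  \<open>phi m \<gamma> u (a, \<beta>)\<close> is minimal where the ansatz density has zeroth moment \<open>fst u\<close>, at \<open>a =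
  theta m \<beta> + ln (fst u) / m0\<close>, and there its value is \<open>fst u\<close> times \<open>phi_hat m \<gamma> (snd u /\<^sub>R
  fst u) \<beta>\<close> plus a constant (\<open>phi_reduced\<close>). As \<open>theta\<close> is Lipschitz, the quadratic term makes
  \<open>phi_hat\<close> coercive, so a minimizer exists; as \<open>exp x \<ge> 1 + x\<close>, no point with another second
  component competes with a critical point of \<open>phi\<close> (\<open>phi_strongly_convex\<close>). Hence the
  multiplier \<open>alpha_opt m \<gamma> u\<close> is unique and its second component is the minimizer \<open>\<beta>\<close> of
  \<open>phi_hat\<close>. Vanishing of the gradient of \<open>phi\<close> at the multiplier reads \<open>moments = u - (fst u
  * \<gamma>) *\<^sub>R (0, \<beta>)\<close>, which is the formula for \<open>u_tilde\<close> and its distance to \<open>u\<close>.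

  For \<open>u_gamma\<close> the gradient of the entropy is needed. Integrating a pointwise Fenchel
  inequality gives weak duality, the ansatz density of the multiplier attains equality, and so
  \<open>entropy m \<gamma> u = - phi m \<gamma> u (alpha_opt m \<gamma> u)\<close> (\<open>strong_duality\<close>). Since \<open>phi\<close> is affine in
  \<open>u\<close>, comparing two moment vectors at each other's multipliers squeezes the increment of the
  entropy between two linear functions; the multiplier depends continuously on \<open>u\<close>, so the
  entropy is differentiable and its gradient is the multiplier, with zeroth entry lowered by
  \<open>\<gamma> / 2 * (norm \<beta>)\<^sup>2\<close> because \<open>fst u\<close> also scales the penalty (\<open>entropy_GDERIV\<close>). As the
  zeroth harmonic is the constant \<open>m0\<close>, the second ansatz density is the first one times \<open>exp
  (- (m0 * \<gamma> / 2 * (norm \<beta>)\<^sup>2))\<close>. Now \<open>m0 \<le> 1\<close> and the triangle inequality give the first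
  bound on \<open>u_gamma\<close>.

  The last inequality bounds \<open>norm (u_tilde m \<gamma> u)\<close> by the mass \<open>fst u * sqrt area_S2\<close> of the
  density times a bound for \<open>norm (m v)\<close>. The sharp bound for the latter is the addition
  theorem, but the estimate has enough room for a weaker one. If \<open>p\<close> is a harmonic polynomial
  of degree \<open>l\<close> and \<open>v\<close> a unit vector, then \<open>(x \<bullet> v) ^ j\<close> is orthogonal to \<open>p\<close> on the sphere
  for \<open>j < l\<close>, while for \<open>j = l\<close> the integral is an explicit multiple of \<open>p v\<close>
  (\<open>integral_S2_harmonic_power\<close>); both follow by induction from the integration by parts
  formula \<open>integral_S2_dir_deriv\<close>. Therefore point values of orthonormal harmonics of degree
  \<open>l\<close> are Fourier coefficients of \<open>q (x \<bullet> v)\<close>, up to a known factor, for any polynomial \<open>q\<close> of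
  degree \<open>l\<close>. Bessel's inequality bounds the sum of their squares in terms of the leading
  coefficient of \<open>q\<close> and its size on \<open>[-1, 1]\<close>. The Chebyshev polynomials are a good choice
  for \<open>q\<close>: they lose a factor at most 4 against the addition theorem, and nothing in degrees 0
  and 1. With the addition theorem the estimate would amount to \<open>area_S2 \<le> (n + 1)\<^sup>2\<close>, which
  leaves a margin of more than a factor 4 as soon as \<open>N \<ge> 2\<close>; for \<open>N = 1\<close> nothing is lost.
\<close>

section \<open>Integration over the sphere\<close>

lemma sets_S2: "sets S2 = sets (restrict_space borel (sphere 0 1))"
  by (simp add: S2_def)

text \<open>
  A measure that is infinite on the whole sphere would be reported as having area 0.
\<close>

lemma finite_measure_S2: "finite_measure S2"
proof
  have "measure S2 (space S2) \<noteq> 0" by (simp add: area_S2_eq)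
  then show "emeasure S2 (space S2) \<noteq> \<infinity>"
    by (auto simp: measure_def)
qed

lemma borel_measurable_S2I:
  "continuous_on (sphere 0 1) f \<Longrightarrow> f \<in> borel_measurable S2"
  using borel_measurable_continuous_on_restrict measurable_cong_sets[OF sets_S2 refl] by blast

lemma integrable_S2I:
  fixes f :: "real^3 \<Rightarrow> 'a::{banach, second_countable_topology}"
  assumes "f \<in> borel_measurable S2" and "\<And>v. v \<in> sphere 0 1 \<Longrightarrow> norm (f v) \<le> B"
  shows "integrable S2 f"
  using finite_measure.integrable_const_bound[OF finite_measure_S2] assms
  by (metis (mono_tags, lifting) AE_I2 space_S2)

lemma integrable_S2_continuous:
  fixes f :: "real^3 \<Rightarrow> real"
  assumes "continuous_on (sphere 0 1) f"
  shows "integrable S2 f"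
proof -
  have "bounded (f ` sphere 0 1)"
    using assms by (intro compact_imp_bounded compact_continuous_image) auto
  then obtain B where "\<And>v. v \<in> sphere 0 1 \<Longrightarrow> norm (f v) \<le> B"
    unfolding bounded_iff by blast
  then show ?thesis
    using integrable_S2I[OF borel_measurable_S2I[OF assms]] by blast
qed

text \<open>
  The surface measure is defined by the volume of cones, so a function on the sphere is
  integrated by extending it constantly along rays into the unit ball. The origin and the
  boundary are null sets.
\<close>

lemma integral_S2_cone:
  fixes f :: "real^3 \<Rightarrow> real"
  assumes f: "f \<in> borel_measurable S2"
  shows "(LINT v|S2. f v) = 3 * (LINT x|lborel. indicator (cball 0 1) x * f (x /\<^sub>R norm x))"
proof -
  let ?M = "restrict_space lborel (ball (0::real^3) 1 - {0})"
  let ?N = "restrict_space borel (sphere (0::real^3) 1)"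
  let ?d = "\<lambda>x::real^3. x /\<^sub>R norm x"
  have meas: "?d \<in> measurable ?M ?N"
    by (intro measurable_restrict_space3) (auto simp: norm_divide)
  have fN: "f \<in> borel_measurable (distr ?M ?N ?d)" "f \<in> borel_measurable ?N"
    using f by (simp_all add: measurable_cong_sets[OF sets_S2 refl])
  have "S2 = density (distr ?M ?N ?d) (\<lambda>_. ennreal 3)"
    unfolding S2_def by (rule measure_eqI) (simp_all add: emeasure_density_const)
  then have "(LINT v|S2. f v) = (LINT v|density (distr ?M ?N ?d) (\<lambda>_. ennreal 3). f v)" by simp
  also have "\<dots> = (LINT v|distr ?M ?N ?d. 3 *\<^sub>R f v)"
    by (rule integral_density) (use fN in auto)
  also have "\<dots> = 3 * (LINT v|distr ?M ?N ?d. f v)"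
    by simp
  also have "(LINT v|distr ?M ?N ?d. f v) = (LINT x|?M. f (?d x))"
    by (rule integral_distr[OF meas fN(2)])
  also have "\<dots> = (LINT x|lborel. indicator (ball 0 1 - {0}) x *\<^sub>R f (?d x))"
    by (rule integral_restrict_space) auto
  also have "\<dots> = (LINT x|lborel. indicator (cball 0 1) x * f (?d x))"
  proof -
    have *: "(\<lambda>x. indicator (ball 0 1 - {0}) x *\<^sub>R f (?d x)) \<in> borel_measurable lborel"
      using measurable_compose[OF meas fN(2)] 
      by (subst (asm) borel_measurable_restrict_space_iff) auto
    have AE0: "AE x in lborel. x \<notin> insert 0 (sphere (0::real^3) 1)"
    proof -
      have "negligible (insert 0 (sphere (0::real^3) 1))" by (simp add: negligible_sphere)
      then have "insert 0 (sphere (0::real^3) 1) \<in> null_sets lebesgue"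
        by (simp add: negligible_iff_null_sets)
      then have "insert 0 (sphere (0::real^3) 1) \<in> null_sets lborel"
        by (auto simp: null_sets_def borel_closed)
      then show ?thesis by (rule AE_not_in)
    qed
    have **: "(\<lambda>x. indicator (cball 0 1) x * f (?d x)) 
        = (\<lambda>x. indicator (ball 0 1 - {0}) x *\<^sub>R f (?d x) + 
            indicator {0} x * f 0 + indicator (sphere 0 1) x * f x)"
      by (auto simp: fun_eq_iff indicator_def)
    have fs: "(\<lambda>x. indicator (sphere 0 1) x * f x) \<in> borel_measurable lborel"
      using fN(2) by (subst (asm) borel_measurable_restrict_space_iff) auto
    show ?thesis
    proof (rule integral_cong_AE)
      show "(\<lambda>x. indicator (cball 0 1) x * f (?d x)) \<in> borel_measurable lborel"
        unfolding ** using * fs by measurable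
      show "AE x in lborel. indicator (ball 0 1 - {0}) x *\<^sub>R f (?d x)
          = indicator (cball 0 1) x * f (?d x)"
        using AE0 by eventually_elim (auto simp: indicator_def)
    qed (rule *)
  qed
  finally show ?thesis .
qed

lemma integral_scaled_cball:
  fixes q :: "real^3 \<Rightarrow> real"
  assumes q[measurable]: "q \<in> borel_measurable borel" and h: "\<And>c x. c > 0 \<Longrightarrow> q (c *\<^sub>R x) = q x"
    and t: "t > 0"
  shows "(LINT x|lborel. indicator (cball 0 t) x * q x) =
    t ^ 3 * (LINT x|lborel. indicator (cball 0 1) x * q x)"
proof -
  have [measurable]: "cball (0::real^3) t \<in> sets borel" by simp
  have "(LINT x|lborel. indicator (cball 0 t) x * q x) =
     (LINT x|density (distr lborel borel (\<lambda>x. 0 + t *\<^sub>R x)) (\<lambda>_. ennreal (\<bar>t\<bar> ^ DIM(real^3))).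
        indicator (cball 0 t) x * q x)"
    using t by (subst lborel_affine[of t 0]) (auto simp: ennreal_power)
  also have "\<dots> = (LINT x|distr lborel borel (\<lambda>x::real^3. 0
      + t *\<^sub>R x). (\<bar>t\<bar> ^ DIM(real^3)) *\<^sub>R (indicator (cball 0 t) x * q x))"
    by (rule integral_density) auto
  also have "\<dots> = (LINT x|lborel. (\<bar>t\<bar> ^ DIM(real^3)) *\<^sub>R (indicator (cball 0 t) (0 + t *\<^sub>R x) * q (0
      + t *\<^sub>R x)))"
    by (rule integral_distr) auto
  also have "\<dots> = (LINT x|lborel. t ^ 3 * (indicator (cball 0 1) x * q x))"
    using t by (intro Bochner_Integration.integral_cong) (auto simp: h indicator_def abs_mult)
  finally show ?thesis by simp
qed

text \<open>
  Layer-cake argument: \<open>1 - norm x ^ k\<close> is the integral of \<open>k * t ^ (k - 1)\<close> over the \<open>t \<le> 1\<close>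
  with \<open>norm x \<le> t\<close>. After exchanging the integrals, the inner one runs over the ball of
  radius \<open>t\<close>, where \<open>q\<close>, being constant along rays, contributes \<open>t ^ 3\<close> times its integral
  over the unit ball.
\<close>

lemma integral_ball_radial_power:
  fixes q :: "real^3 \<Rightarrow> real"
  assumes q[measurable]: "q \<in> borel_measurable borel" and h: "\<And>c x. c > 0 \<Longrightarrow> q (c *\<^sub>R x) = q x"
    and b: "\<And>x. \<bar>q x\<bar> \<le> C"
  shows "(LINT x|lborel. indicator (cball 0 1) x * (norm x ^ k * q x)) =
    3 / (k + 3) * (LINT x|lborel. indicator (cball 0 1) x * q x)"
proof (cases k)
  case 0
  then show ?thesis by simp
next
  case (Suc j)
  let ?B = "cball (0::real^3) 1"
  let ?Q = "LINT x|lborel. indicator ?B x * q x"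
  define f where "f = (\<lambda>(x::real^3) (t::real). indicator ?B x * q x * (indicator {0..1} t * (if norm
      x \<le> t then t ^ j else 0)))"
  have C0: "C \<ge> 0" using b[of 0] by linarith
  have [measurable]: "?B \<in> sets borel" by simp
  have fm[measurable]: "(\<lambda>(x, t). f x t) \<in> borel_measurable (lborel \<Otimes>\<^sub>M lborel)"
    unfolding f_def by measurable
  have "integrable (lborel \<Otimes>\<^sub>M lborel) (\<lambda>(x, t). f x t)"
  proof (rule integrableI_bounded_set[where A = "?B \<times> {0..1}" and B = C])
    show "emeasure (lborel \<Otimes>\<^sub>M lborel) (?B \<times> {0..1::real}) < \<infinity>"
      by (subst lborel.emeasure_pair_measure_Times)
        (use emeasure_lborel_cball_finite[of "0::real^3" 1] in \<open>auto simp: ennreal_mult_less_top\<close>)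
    have "t ^ j \<le> 1" if "0 \<le> t" "t \<le> 1" for t :: real
      using that by (simp add: power_le_one)
    then show "AE x in lborel \<Otimes>\<^sub>M lborel. x \<in> ?B \<times> {0..1} \<longrightarrow> norm (case x of (x, t) \<Rightarrow> f x t) \<le> C"
      using b C0 by (auto simp: f_def abs_mult intro!: AE_I2 mult_left_le order_trans[OF
          mult_mono[OF b, where d = 1]])
    show "AE x in lborel \<Otimes>\<^sub>M lborel. x \<notin> ?B \<times> {0..1} \<longrightarrow> (case x of (x, t) \<Rightarrow> f x t) = 0"
      by (auto simp: f_def indicator_def intro!: AE_I2)
  qed (auto)
  then have Fub: "(LINT t|lborel. LINT x|lborel. f x t) = (LINT x|lborel. LINT t|lborel. f x t)"
    by (rule lborel_pair.Fubini_integral)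
  have "(LINT t|lborel. f x t) = (indicator ?B x * q x - indicator ?B x * (norm x ^ k * q x)) / k"
      for x
  proof (cases "x \<in> ?B")
    case True
    have "(LINT t|lborel. f x t) = (LINT t|lborel. q x * (t ^ j * indicator {norm x..1} t))"
    proof (intro Bochner_Integration.integral_cong refl)
      fix t :: real
      have "norm x \<le> t \<Longrightarrow> 0 \<le> t" using norm_ge_zero[of x] by linarith
      then show "f x t = q x * (t ^ j * indicator {norm x..1} t)"
        using True by (auto simp: f_def indicator_def)
    qed
    also have "\<dots> = q x * (LINT t|lborel. t ^ j * indicator {norm x..1} t)"
      by simp
    also have "(LINT t|lborel. t ^ j * indicator {norm x..1} t) = (1 - norm x ^ k) / k"
      using True integral_power[of "norm x" 1 j] by (simp add: Suc)
    finally show ?thesis using True by (simp add: algebra_simps diff_divide_distrib)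
  qed (simp add: f_def)
  then have 1: "(LINT x|lborel. LINT t|lborel. f x t)
      = (LINT x|lborel. (indicator ?B x * q x - indicator ?B x * (norm x ^ k * q x)) / k)"
    by simp
  have i1: "integrable lborel (\<lambda>x. indicator ?B x * q x)"
    by (rule integrableI_bounded_set[where A = ?B and B = C])
      (use emeasure_lborel_cball_finite[of "0::real^3" 1] in \<open>auto simp: b indicator_def\<close>)
  have i2: "integrable lborel (\<lambda>x. indicator ?B x * (norm x ^ k * q x))"
  proof (rule integrableI_bounded_set[where A = ?B and B = C])
    show "AE x in lborel. x \<in> ?B \<longrightarrow> norm (indicator ?B x * (norm x ^ k * q x)) \<le> C"
    proof (intro AE_I2 impI)
      fix x :: "real^3" assume "x \<in> ?B"
      then have "norm x ^ k \<le> 1" by (simp add: power_le_one)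
      then have "norm x ^ k * \<bar>q x\<bar> \<le> 1 * C" using b by (intro mult_mono) auto
      then show "norm (indicator ?B x * (norm x ^ k * q x)) \<le> C" using C0
          by (auto simp: indicator_def abs_mult)
    qed
  qed (use emeasure_lborel_cball_finite[of "0::real^3" 1] in auto)
  have 2: "(LINT x|lborel. LINT t|lborel. f x t)
      = (?Q - (LINT x|lborel. indicator ?B x * (norm x ^ k * q x))) / k"
    unfolding 1 using i1 i2 by simp
  have "(LINT x|lborel. f x t) = (t ^ (k + 2) * indicator {0..1} t) * ?Q" for t
  proof (cases "0 < t \<and> t \<le> 1")
    case True
    have "(LINT x|lborel. f x t) = (LINT x|lborel. t ^ j * (indicator (cball 0 t) x * q x))"
      using True by (intro Bochner_Integration.integral_cong) (auto simp: f_def indicator_def)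
    also have "\<dots> = t ^ j * (t ^ 3 * ?Q)"
      using integral_scaled_cball[OF q h, of t] True by simp
    also have "\<dots> = (t ^ (k + 2) * indicator {0..1} t) * ?Q"
      using True by (simp add: Suc power_add power2_eq_square power3_eq_cube)
    finally show ?thesis .
  next
    case False
    have "f x 0 = indicator {0} x * (q 0 * 0 ^ j)" for x by (simp add: f_def indicator_def)
    then have "(LINT x|lborel. f x 0) = (LINT x|lborel. indicator {0::real^3} x * (q 0 * 0 ^ j))"
        by simp
    also have "(LINT x|lborel. indicator {0::real^3} x * (q 0 * 0 ^ j)) = 0" by simp
    finally show ?thesis using False by (cases "t = 0") (auto simp: f_def Suc)
  qed
  then have "(LINT t|lborel. LINT x|lborel. f x t)
      = (LINT t|lborel. t ^ (k + 2) * indicator {0..1} t) * ?Q"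
    by simp
  also have "(LINT t|lborel. t ^ (k + 2) * indicator {0..1::real} t) = 1 / (k + 3)"
    using integral_power[of "0::real" 1 "k + 2"] by (simp add: Suc)
  finally have "(?Q - (LINT x|lborel. indicator ?B x * (norm x ^ k * q x))) / k = 1 / (k + 3) * ?Q"
    using 2 Fub by simp
  then have "?Q - (LINT x|lborel. indicator ?B x * (norm x ^ k * q x)) = k / (k + 3) * ?Q"
    using Suc by (simp add: field_simps)
  then show ?thesis
    by (simp add: field_simps) 
qed

text \<open>
  Only positive factors are demanded, so the condition says nothing about the value at the
  origin (for \<open>d > 0\<close> it is forced by continuity) and passes to derivatives without a special
  case there.
\<close>

definition homogeneous :: "nat \<Rightarrow> ('a::real_vector \<Rightarrow> real) \<Rightarrow> bool" where
  "homogeneous d F \<longleftrightarrow> (\<forall>c>0. \<forall>x. F (c *\<^sub>R x) = c ^ d * F x)"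

text \<open>
  Polar coordinates for a homogeneous integrand; the divisor is the reciprocal of the integral
  of \<open>t ^ (j + d + 2)\<close> over \<open>[0, 1]\<close>.
\<close>

lemma integral_polar:
  fixes F :: "real^3 \<Rightarrow> real"
  assumes F: "continuous_on UNIV F" and hom: "homogeneous d F"
  shows "(LINT x|lborel. indicator (cball 0 1) x * (norm x ^ j * F x))
      = (LINT v|S2. F v) / (j + d + 3)"
proof -
  define q where "q x = (if x = 0 then 0 else F (x /\<^sub>R norm x))" for x
  have [measurable]: "F \<in> borel_measurable borel" using F by (rule borel_measurable_continuous_onI)
  have [measurable]: "cball (0::real^3) 1 \<in> sets borel" by simp
  have q[measurable]: "q \<in> borel_measurable borel" unfolding q_def by measurable
  have qh: "q (c *\<^sub>R x) = q x" if "c > 0" for c x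
  proof -
    have "(c *\<^sub>R x) /\<^sub>R norm (c *\<^sub>R x) = x /\<^sub>R norm x"
      using that by (simp add: field_simps)
    then show ?thesis unfolding q_def using that by (metis scale_eq_0_iff less_irrefl)
  qed
  have "bounded (F ` sphere 0 1)"
    using F by (intro compact_imp_bounded compact_continuous_image) (auto intro: continuous_on_subset)
  then obtain C where C: "\<And>v. v \<in> sphere 0 1 \<Longrightarrow> \<bar>F v\<bar> \<le> C" and "C > 0"
    unfolding bounded_pos by (metis image_eqI real_norm_def)
  then have qb: "\<bar>q x\<bar> \<le> C" for x
    by (auto simp: q_def intro: less_imp_le C)
  have Fq: "F x = norm x ^ d * q x" if "x \<noteq> 0" for x
    using hom[unfolded homogeneous_def, rule_format, of "norm x" "x /\<^sub>R norm x"] that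
        by (simp add: q_def)
  have AE0: "AE x in lborel. x \<noteq> (0::real^3)" by (rule AE_lborel_singleton)
  have "(LINT v|S2. F v) = 3 * (LINT x|lborel. indicator (cball 0 1) x * F (x /\<^sub>R norm x))"
    using F by (intro integral_S2_cone borel_measurable_S2I) (auto intro: continuous_on_subset)
  also have "(LINT x|lborel. indicator (cball 0 1) x * F (x /\<^sub>R norm x))
      = (LINT x|lborel. indicator (cball 0 1) x * q x)"
  proof (rule integral_cong_AE)
    show "AE x in lborel. indicator (cball 0 1) x * F (x /\<^sub>R norm x) = indicator (cball 0 1) x * q x"
      using AE0 by eventually_elim (simp add: q_def)
  qed measurable
  finally have "(LINT x|lborel. indicator (cball 0 1) x * (norm x ^ (j + d) * q x))
      = (LINT v|S2. F v) / (j + d + 3)"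
    using integral_ball_radial_power[OF q qh qb, of "j + d"] by simp
  also have "(LINT x|lborel. indicator (cball 0 1) x * (norm x ^ (j + d) * q x))
      = (LINT x|lborel. indicator (cball 0 1) x * (norm x ^ j * F x))"
  proof (rule integral_cong_AE)
    show "AE x in lborel. indicator (cball 0 1) x * (norm x ^ (j + d) * q x)
        = indicator (cball 0 1) x * (norm x ^ j * F x)"
      using AE0 by eventually_elim (simp add: Fq power_add)
  qed measurable
  finally show ?thesis .
qed

section \<open>Directional derivatives of polynomials\<close>

text \<open>
  The derivative in one real variable from which the Laplacian is built.
\<close>

definition dir_deriv :: "'a::real_normed_vector \<Rightarrow> ('a \<Rightarrow> real) \<Rightarrow> 'a \<Rightarrow> real" where
  "dir_deriv v p x = deriv (\<lambda>t. p (x + t *\<^sub>R v)) 0"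

lemma dir_derivI:
  "((\<lambda>t. p (x + t *\<^sub>R v)) has_real_derivative D) (at 0) \<Longrightarrow> dir_deriv v p x = D"
  unfolding dir_deriv_def by (rule DERIV_imp_deriv)

text \<open>
  Structural induction over the four ways to build a polynomial function; the witness is given
  by the sum and product rules.
\<close>

lemma polynomial_dir_deriv_exists:
  fixes p :: "'a::real_normed_vector \<Rightarrow> real"
  assumes "real_polynomial_function p"
  shows "\<exists>p'. real_polynomial_function p' \<and>
    (\<forall>x. ((\<lambda>t. p (x + t *\<^sub>R v)) has_real_derivative p' x) (at 0))"
  using assms
proof (induction rule: real_polynomial_function.induct)
  case (linear f)
  interpret f: bounded_linear f by fact
  show ?case
    by (rule exI[of _ "\<lambda>_. f v"]) (auto simp: f.add f.scale intro!: derivative_eq_intros)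
next
  case (const c)
  show ?case by (rule exI[of _ "\<lambda>_. 0"]) auto
next
  case (add f g)
  then obtain f' g' where "real_polynomial_function f'" "real_polynomial_function g'"
    "\<And>x. ((\<lambda>t. f (x + t *\<^sub>R v)) has_real_derivative f' x) (at 0)"
    "\<And>x. ((\<lambda>t. g (x + t *\<^sub>R v)) has_real_derivative g' x) (at 0)" by metis
  then show ?case
    by (intro exI[of _ "\<lambda>x. f' x + g' x"]) (auto intro!: derivative_eq_intros)
next
  case (mult f g)
  then obtain f' g' where "real_polynomial_function f'" "real_polynomial_function g'"
    "\<And>x. ((\<lambda>t. f (x + t *\<^sub>R v)) has_real_derivative f' x) (at 0)"
    "\<And>x. ((\<lambda>t. g (x + t *\<^sub>R v)) has_real_derivative g' x) (at 0)" by metis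
  with mult show ?case
    by (intro exI[of _ "\<lambda>x. f' x * g x + g' x * f x"]) (auto intro!: derivative_eq_intros)
qed

lemma polynomial_dir_deriv [intro]:
  "real_polynomial_function p \<Longrightarrow> real_polynomial_function (dir_deriv v p)"
proof -
  assume "real_polynomial_function p"
  from polynomial_dir_deriv_exists[OF this, of v] obtain p' where "real_polynomial_function p'"
    "\<And>x. ((\<lambda>t. p (x + t *\<^sub>R v)) has_real_derivative p' x) (at 0)" by blast
  moreover from this(2) have "dir_deriv v p = p'" by (intro ext dir_derivI)
  ultimately show ?thesis by simp
qed

lemma has_dir_deriv:
  assumes "real_polynomial_function p"
  shows "((\<lambda>t. p (x + t *\<^sub>R v)) has_real_derivative dir_deriv v p (x + t *\<^sub>R v)) (at t)"
proof -
  from polynomial_dir_deriv_exists[OF assms, of v] obtain p' where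
    p': "\<And>x. ((\<lambda>t. p (x + t *\<^sub>R v)) has_real_derivative p' x) (at 0)" by blast
  then have "dir_deriv v p = p'" by (intro ext dir_derivI)
  with p'[of "x + t *\<^sub>R v"] have
    "((\<lambda>s. p (x + (t + s) *\<^sub>R v)) has_real_derivative dir_deriv v p (x + t *\<^sub>R v)) (at 0)"
    by (simp add: algebra_simps)
  then show ?thesis
    using DERIV_shift[of "\<lambda>t. p (x + t *\<^sub>R v)" _ 0 t] by (simp add: add.commute)
qed

lemma has_dir_deriv_0:
  assumes "real_polynomial_function p"
  shows "((\<lambda>t. p (x + t *\<^sub>R v)) has_real_derivative dir_deriv v p x) (at 0)"
  using has_dir_deriv[OF assms, of x v 0] by simp

lemma dir_deriv_bounded_linear: "bounded_linear f \<Longrightarrow> dir_deriv v f = (\<lambda>x. f v)"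
proof (intro ext dir_derivI)
  fix x assume "bounded_linear f"
  then interpret f: bounded_linear f .
  show "((\<lambda>t. f (x + t *\<^sub>R v)) has_real_derivative f v) (at 0)"
    by (auto simp: f.add f.scale intro!: derivative_eq_intros)
qed

lemma dir_deriv_const [simp]: "dir_deriv v (\<lambda>x. c) = (\<lambda>x. 0)"
  by (intro ext dir_derivI) auto

lemma dir_deriv_add:
  "real_polynomial_function f \<Longrightarrow> real_polynomial_function g \<Longrightarrow>
   dir_deriv v (\<lambda>x. f x + g x) = (\<lambda>x. dir_deriv v f x + dir_deriv v g x)"
  by (intro ext dir_derivI) (auto intro!: derivative_eq_intros has_dir_deriv_0)

lemma dir_deriv_mult:
  "real_polynomial_function f \<Longrightarrow> real_polynomial_function g \<Longrightarrow>
   dir_deriv v (\<lambda>x. f x * g x) = (\<lambda>x. dir_deriv v f x * g x + f x * dir_deriv v g x)"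
  by (intro ext dir_derivI) (auto intro!: derivative_eq_intros has_dir_deriv_0)

lemma dir_deriv_sum:
  assumes "finite I" "\<And>i. i \<in> I \<Longrightarrow> real_polynomial_function (f i)"
  shows "dir_deriv v (\<lambda>x. \<Sum>i\<in>I. f i x) = (\<lambda>x. \<Sum>i\<in>I. dir_deriv v (f i) x)"
  using assms by (intro ext dir_derivI) (auto intro!: derivative_eq_intros has_dir_deriv_0)

lemma dir_deriv_power:
  assumes "real_polynomial_function f"
  shows "dir_deriv v (\<lambda>x. f x ^ k) = (\<lambda>x. k * f x ^ (k - 1) * dir_deriv v f x)"
  using assms by (intro ext dir_derivI) (auto intro!: derivative_eq_intros has_dir_deriv_0)

lemma dir_deriv_commute:
  assumes "real_polynomial_function p"
  shows "dir_deriv v (dir_deriv w p) = dir_deriv w (dir_deriv v p)"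
  using assms
proof (induction rule: real_polynomial_function.induct)
  case (linear f)
  then show ?case by (simp add: dir_deriv_bounded_linear)
next
  case (add f g)
  then show ?case by (simp add: dir_deriv_add polynomial_dir_deriv)
next
  case (mult f g)
  then show ?case
    by (simp add: dir_deriv_add dir_deriv_mult polynomial_dir_deriv real_polynomial_function.intros
        fun_eq_iff algebra_simps)
qed simp

text \<open>
  Linearity in the direction, again by structural induction.
\<close>

lemma dir_deriv_decompose:
  fixes p :: "'a::euclidean_space \<Rightarrow> real"
  assumes "real_polynomial_function p"
  shows "dir_deriv v p x = (\<Sum>b\<in>Basis. (v \<bullet> b) * dir_deriv b p x)"
  using assms
proof (induction arbitrary: x rule: real_polynomial_function.induct)
  case (linear f)
  interpret f: bounded_linear f by fact
  have "f v = f (\<Sum>b\<in>Basis. (v \<bullet> b) *\<^sub>R b)" by (simp add: euclidean_representation)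
  then show ?case by (simp add: dir_deriv_bounded_linear linear f.sum f.scale)
next
  case (add f g)
  then show ?case by (simp add: dir_deriv_add sum.distrib distrib_left)
next
  case (mult f g)
  then show ?case by (simp add: dir_deriv_mult sum.distrib distrib_left sum_distrib_right
      sum_distrib_left mult_ac)
qed simp

lemma laplacian_dir_deriv:
  fixes p :: "'a::euclidean_space \<Rightarrow> real"
  assumes "real_polynomial_function p"
  shows "laplacian p x = (\<Sum>b\<in>Basis. dir_deriv b (dir_deriv b p) x)"
proof -
  have "deriv (\<lambda>t. p (x + t *\<^sub>R b)) = (\<lambda>t. dir_deriv b p (x + t *\<^sub>R b))" for b
    by (intro ext DERIV_imp_deriv has_dir_deriv assms)
  then show ?thesis
    by (simp add: laplacian_def numeral_2_eq_2 dir_deriv_def[of _ "dir_deriv _ p"])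
qed

text \<open>
  In particular the directional derivatives of a harmonic polynomial are harmonic.
\<close>

lemma laplacian_dir_deriv_commute:
  fixes p :: "'a::euclidean_space \<Rightarrow> real"
  assumes p: "real_polynomial_function p"
  shows "laplacian (dir_deriv v p) x = dir_deriv v (laplacian p) x"
proof -
  have "laplacian p = (\<lambda>x. \<Sum>b\<in>Basis. dir_deriv b (dir_deriv b p) x)"
    using laplacian_dir_deriv[OF p] by blast
  then have "dir_deriv v (laplacian p) x = (\<Sum>b\<in>Basis. dir_deriv v (dir_deriv b (dir_deriv b p)) x)"
    using p by (simp add: dir_deriv_sum polynomial_dir_deriv)
  also have "\<dots> = laplacian (dir_deriv v p) x"
    using p by (simp add: laplacian_dir_deriv polynomial_dir_deriv dir_deriv_commute[of _ v])
  finally show ?thesis by simp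
qed

lemma homogeneous_mult:
  "homogeneous d f \<Longrightarrow> homogeneous e g \<Longrightarrow> homogeneous (d + e) (\<lambda>x. f x * g x)"
  by (auto simp: homogeneous_def power_add)

lemma homogeneous_inner: "homogeneous 1 (\<lambda>x. x \<bullet> v)"
  by (auto simp: homogeneous_def)

lemma homogeneous_inner_power: "homogeneous j (\<lambda>x. (x \<bullet> v) ^ j)"
  by (auto simp: homogeneous_def power_mult_distrib)

text \<open>
  The extra factor \<open>c\<close> on the left avoids the exponent \<open>d - 1\<close>, so that degree 0 is covered.
\<close>

lemma dir_deriv_scaled:
  assumes p: "real_polynomial_function p" and h: "homogeneous d p" and c: "c > 0"
  shows "c * dir_deriv v p (c *\<^sub>R x) = c ^ d * dir_deriv v p x"
proof -
  have "((\<lambda>t. p (c *\<^sub>R x + (c * t) *\<^sub>R v)) has_real_derivative c * dir_deriv v p (c *\<^sub>R x)) (at 0)"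
  proof -
    have "((\<lambda>t. p (c *\<^sub>R x + t *\<^sub>R v)) has_real_derivative dir_deriv v p (c *\<^sub>R x)) (at (c * 0))"
      using has_dir_deriv_0[OF p] by simp
    from DERIV_chain2[OF this DERIV_cmult_Id[of c]] show ?thesis by (simp add: mult.commute)
  qed
  moreover have "p (c *\<^sub>R x + (c * t) *\<^sub>R v) = c ^ d * p (x + t *\<^sub>R v)" for t
    using h[unfolded homogeneous_def, rule_format, OF c, of "x + t *\<^sub>R v"]
        by (simp add: algebra_simps)
  moreover have "((\<lambda>t. c ^ d * p (x + t *\<^sub>R v)) has_real_derivative c ^ d * dir_deriv v p x) (at 0)"
    by (intro DERIV_cmult has_dir_deriv_0 p)
  ultimately show ?thesis by (auto dest: DERIV_unique)
qed

lemma homogeneous_dir_deriv: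
  assumes "real_polynomial_function p" "homogeneous (Suc d) p"
  shows "homogeneous d (dir_deriv v p)"
  unfolding homogeneous_def using dir_deriv_scaled[OF assms] by (auto simp: field_simps)

text \<open>
  Along the ray through \<open>x\<close> the polynomial is \<open>(1 + t) ^ d * p x\<close>.
\<close>

lemma euler_homogeneous:
  assumes p: "real_polynomial_function p" and h: "homogeneous d p"
  shows "dir_deriv x p x = d * p x"
proof (rule dir_derivI)
  have "((\<lambda>t. (1 + t) ^ d * p x) has_real_derivative d * p x) (at 0)"
    by (auto intro!: derivative_eq_intros)
  then show "((\<lambda>t. p (x + t *\<^sub>R x)) has_real_derivative d * p x) (at 0)"
  proof (rule has_field_derivative_transform_within_open[where S = "{-1<..}"])
    fix t :: real assume "t \<in> {-1<..}"
    then show "(1 + t) ^ d * p x = p (x + t *\<^sub>R x)"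
      using h[unfolded homogeneous_def, rule_format, of "1 + t" x] by (simp add: algebra_simps)
  qed auto
qed

text \<open>
  The value is the same along a ray, down to its limit at the origin.
\<close>

lemma homogeneous_0_const:
  fixes p :: "'a::euclidean_space \<Rightarrow> real"
  assumes p: "real_polynomial_function p" and h: "homogeneous 0 p"
  shows "p x = p 0"
proof -
  have "(\<lambda>n. p (inverse (real (Suc n)) *\<^sub>R x)) \<longlonglongrightarrow> p (0 *\<^sub>R x)"
    by (intro isCont_tendsto_compose[OF continuous_real_polymonial_function[OF p]] tendsto_intros
        LIMSEQ_inverse_real_of_nat)
  moreover have "p (inverse (real (Suc n)) *\<^sub>R x) = p x" for n
    using h[unfolded homogeneous_def, rule_format, of "inverse (real (Suc n))" x] by simp
  ultimately show ?thesis by (simp add: LIMSEQ_const_iff)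
qed

lemma homogeneous_0_dir_deriv:
  fixes p :: "'a::euclidean_space \<Rightarrow> real"
  assumes p: "real_polynomial_function p" and h: "homogeneous 0 p"
  shows "dir_deriv v p x = 0"
proof -
  have "p = (\<lambda>x. p 0)" using homogeneous_0_const[OF assms] by blast
  then show ?thesis by (metis dir_deriv_const)
qed

section \<open>Integration by parts on the sphere\<close>

text \<open>
  The integral of \<open>\<Phi> (x + t *\<^sub>R v)\<close> does not depend on \<open>t\<close>. The difference quotients in \<open>t\<close>
  therefore have integral 0; by the mean value theorem they are dominated by the maximum of
  \<open>\<bar>D\<bar>\<close> on a ball, and they converge to \<open>D\<close>.
\<close>

lemma integral_dir_deriv_compact_support:
  fixes \<Phi> D :: "'a::euclidean_space \<Rightarrow> real"
  assumes der: "\<And>x t. ((\<lambda>t. \<Phi> (x + t *\<^sub>R v)) has_real_derivative D (x + t *\<^sub>R v)) (at t)"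
    and cont: "continuous_on UNIV \<Phi>" "continuous_on UNIV D"
    and supp: "\<And>x. norm x \<ge> 1 \<Longrightarrow> \<Phi> x = 0" "\<And>x. norm x \<ge> 1 \<Longrightarrow> D x = 0"
  shows "(LINT x|lborel. D x) = 0"
proof -
  have [measurable]: "\<Phi> \<in> borel_measurable borel" "D \<in> borel_measurable borel"
    using cont by (auto intro: borel_measurable_continuous_onI)
  have bd: "\<exists>C. \<forall>x. \<bar>F x\<bar> \<le> C" if "continuous_on UNIV F" "\<And>x. norm x \<ge> 1 \<Longrightarrow> F x = 0"
      for F :: "'a \<Rightarrow> real"
  proof -
    have "bounded (F ` cball 0 1)"
      using that(1) by (intro compact_imp_bounded compact_continuous_image) (auto intro:
          continuous_on_subset)
    then obtain C where C: "\<And>x. x \<in> cball 0 1 \<Longrightarrow> \<bar>F x\<bar> \<le> C" "C > 0"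
      unfolding bounded_pos by (metis image_eqI real_norm_def)
    have "\<bar>F x\<bar> \<le> C" for x
      using C that(2)[of x] by (cases "norm x \<le> 1") auto
    then show ?thesis by blast
  qed
  obtain C where C: "\<And>x. \<bar>D x\<bar> \<le> C" using bd[OF cont(2) supp(2)] by blast
  obtain B where B: "\<And>x. \<bar>\<Phi> x\<bar> \<le> B" using bd[OF cont(1) supp(1)] by blast
  have C0: "C \<ge> 0" using C[of 0] by linarith
  let ?R = "cball (0::'a) (1 + norm v)"
  have fin: "emeasure lborel ?R < \<infinity>" by (rule emeasure_lborel_cball_finite)
  define h where "h n = inverse (real (Suc n))" for n
  have h: "0 < h n" "h n \<le> 1" for n by (auto simp: h_def divide_simps)
  define s where "s n x = (\<Phi> (x + h n *\<^sub>R v) - \<Phi> x) / h n" for n x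
  have lim: "(\<lambda>n. s n x) \<longlonglongrightarrow> D x" for x
  proof -
    have "((\<lambda>t. (\<Phi> (x + t *\<^sub>R v) - \<Phi> x) / t) \<longlongrightarrow> D x) (at 0)"
      using der[of x 0] by (simp add: DERIV_def)
    moreover have "filterlim h (at 0) sequentially"
      unfolding filterlim_at h_def using LIMSEQ_inverse_real_of_nat by auto
    ultimately show ?thesis unfolding s_def by (rule filterlim_compose)
  qed
  have outside: "norm (x + t *\<^sub>R v) \<ge> 1" if "x \<notin> ?R" "0 \<le> t" "t \<le> 1" for x t
  proof -
    have "norm (t *\<^sub>R v) \<le> 1 * norm v" using that unfolding norm_scaleR
        by (intro mult_right_mono) auto
    moreover have "norm x \<le> norm (x + t *\<^sub>R v) + norm (t *\<^sub>R v)"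
      by (metis add_diff_cancel_right' norm_triangle_ineq4)
    ultimately show ?thesis using that by auto
  qed
  have sb: "\<bar>s n x\<bar> \<le> C * indicator ?R x" for n x
  proof (cases "x \<in> ?R")
    case True
    obtain z where "\<Phi> (x + h n *\<^sub>R v) - \<Phi> (x + 0 *\<^sub>R v) = (h n - 0) * D (x + z *\<^sub>R v)"
      using MVT2[OF h(1)[of n], of "\<lambda>t. \<Phi> (x + t *\<^sub>R v)" "\<lambda>t. D (x + t *\<^sub>R v)"] der by blast
    then have "s n x = D (x + z *\<^sub>R v)" using h(1)[of n] by (simp add: s_def)
    then show ?thesis using True C by simp
  next
    case False
    then show ?thesis
      using outside[OF False, of 0] outside[OF False, of "h n"] h[of n] supp(1) by (simp add: s_def)
  qed
  have sm[measurable]: "s n \<in> borel_measurable lborel" for n unfolding s_def by measurable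
  have "(\<lambda>n. LINT x|lborel. s n x) \<longlonglongrightarrow> (LINT x|lborel. D x)"
  proof (rule integral_dominated_convergence)
    show "integrable lborel (\<lambda>x. C * indicator ?R x)" using fin by (auto simp: less_top[symmetric])
  qed (use lim sb in auto)
  moreover have "(LINT x|lborel. s n x) = 0" for n
  proof -
    have i: "integrable lborel \<Phi>"
      by (rule integrableI_bounded_set[where A = ?R and B = B])
        (use fin B supp(1) outside[of _ 0] in auto)
    have eq: "(LINT x|lborel. \<Phi> (x + h n *\<^sub>R v)) = (LINT x|lborel. \<Phi> x)"
      by (subst (2) lborel_distr_plus[of "h n *\<^sub>R v", symmetric], subst integral_distr) (auto simp:
          add.commute)
    have "integrable lborel (\<lambda>x. \<Phi> (x + h n *\<^sub>R v))"
    proof -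
      have "integrable (distr lborel borel (\<lambda>x. h n *\<^sub>R v + x)) \<Phi>"
        using i by (simp add: lborel_distr_plus)
      then show ?thesis by (subst (asm) integrable_distr_eq) (auto simp: add.commute)
    qed
    then show ?thesis using i eq by (simp add: s_def)
  qed
  ultimately show ?thesis by (simp add: LIMSEQ_const_iff)
qed

text \<open>
  This replaces the divergence theorem. The function \<open>(max 0 (1 - x \<bullet> x))\<^sup>2 * F x\<close> is
  continuously differentiable with support in the unit ball, so the integral of its derivative
  vanishes. Both parts of that derivative are sums of homogeneous functions times powers of
  \<open>norm x\<close>, and polar coordinates turn their integrals into integrals over the sphere.
\<close>

lemma integral_S2_dir_deriv:
  fixes F :: "real^3 \<Rightarrow> real"
  assumes F: "real_polynomial_function F" and hom: "homogeneous d F"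
  shows "(LINT x|S2. dir_deriv v F x) = (d + 2) * (LINT x|S2. (x \<bullet> v) * F x)"
proof -
  define m where "m x = max 0 (1 - x \<bullet> x)" for x :: "real^3"
  define G where "G = (\<lambda>x. (x \<bullet> v) * F x)"
  define D where "D x = (m x)\<^sup>2 * dir_deriv v F x - 4 * m x * G x" for x
  have poly: "real_polynomial_function (\<lambda>x. x \<bullet> v)"
    by (intro real_polynomial_function.intros(1) bounded_linear_inner_left)
  then have polyG: "real_polynomial_function G" unfolding G_def using F by auto
  have polyD: "real_polynomial_function (dir_deriv v F)" using F by auto
  have cont: "continuous_on UNIV p" if "real_polynomial_function p" for p :: "real^3 \<Rightarrow> real"
    using that continuous_real_polymonial_function continuous_at_imp_continuous_on by blast
  have homG: "homogeneous (d + 1) G"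
    unfolding G_def using homogeneous_mult[OF homogeneous_inner hom] by (simp add: add.commute)
  have contm: "continuous_on UNIV m" unfolding m_def by (intro continuous_intros)
  have msq: "((\<lambda>s. (max 0 s)\<^sup>2) has_real_derivative 2 * max 0 s) (at s)" for s :: real
  proof -
    consider "s < 0" | "s = 0" | "s > 0" by linarith
    then show ?thesis
    proof cases
      case 1
      have "((\<lambda>s::real. 0) has_real_derivative 0) (at s)" by simp
      then have "((\<lambda>s. (max 0 s)\<^sup>2) has_real_derivative 0) (at s)"
        by (rule has_field_derivative_transform_within_open[where S = "{..<0}"]) (use 1 in auto)
      then show ?thesis using 1 by simp
    next
      case 2
      have "((\<lambda>h. (max 0 h)\<^sup>2 / h) \<longlongrightarrow> 0) (at (0::real))"
      proof (rule Lim_null_comparison)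
        show "\<forall>\<^sub>F h in at (0::real). norm ((max 0 h)\<^sup>2 / h) \<le> \<bar>h\<bar>"
          by (intro always_eventually) (auto simp: max_def power2_eq_square)
        show "((\<lambda>h. \<bar>h\<bar>) \<longlongrightarrow> 0) (at (0::real))" by (intro tendsto_eq_intros) auto
      qed
      then show ?thesis using 2 by (simp add: DERIV_def)
    next
      case 3
      have "((\<lambda>s. s\<^sup>2) has_real_derivative 2 * s) (at s)" by (auto intro!: derivative_eq_intros)
      then have "((\<lambda>s. (max 0 s)\<^sup>2) has_real_derivative 2 * s) (at s)"
        by (rule has_field_derivative_transform_within_open[where S = "{0<..}"]) (use 3 in auto)
      then show ?thesis using 3 by simp
    qed
  qed
  have "(LINT x|lborel. D x) = 0"
  proof (rule integral_dir_deriv_compact_support)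
    fix x :: "real^3" and t :: real
    let ?y = "x + t *\<^sub>R v"
    have 1: "((\<lambda>t. 1 - (x + t *\<^sub>R v) \<bullet> (x + t *\<^sub>R v)) has_real_derivative - 2 * (?y \<bullet> v)) (at t)"
      by (auto simp: inner_add_left inner_add_right inner_commute algebra_simps intro!:
          derivative_eq_intros)
    have 2: "((\<lambda>t. (m (x + t *\<^sub>R v))\<^sup>2) has_real_derivative 2 * m ?y * (- 2 * (?y \<bullet> v))) (at t)"
      unfolding m_def by (rule DERIV_chain2[OF msq 1])
    show "((\<lambda>t. (m (x + t *\<^sub>R v))\<^sup>2 * F (x + t *\<^sub>R v)) has_real_derivative D ?y) (at t)"
      using DERIV_mult[OF 2 has_dir_deriv[OF F, of x v t]] by (simp add: D_def G_def algebra_simps)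
  next
    show "continuous_on UNIV (\<lambda>x. (m x)\<^sup>2 * F x)" "continuous_on UNIV D"
      unfolding D_def by (intro continuous_intros contm cont F polyD polyG)+
  next
    fix x :: "real^3" assume "1 \<le> norm x"
    then have "x \<bullet> x \<ge> 1" by (simp add: dot_square_norm)
    then have "m x = 0" by (simp add: m_def)
    then show "(m x)\<^sup>2 * F x = 0" "D x = 0" by (simp_all add: D_def)
  qed
  have intB: "integrable lborel (\<lambda>x. indicator (cball 0 1) x * f x)" if "continuous_on UNIV f"
      for f :: "real^3 \<Rightarrow> real"
    using borel_integrable_compact[of "cball 0 1" f] that by (auto intro: continuous_on_subset)
  define P where "P k x = indicator (cball 0 1) x * (norm x ^ k * dir_deriv v F x)" for k x
  define Q where "Q k x = indicator (cball 0 1) x * (norm x ^ k * G x)" for k x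
  have intPQ: "integrable lborel (P k)" "integrable lborel (Q k)" for k
    unfolding P_def[abs_def] Q_def[abs_def] by (intro intB continuous_intros cont polyD polyG)+
  have "D x = P 0 x - 2 * P 2 x + P 4 x - 4 * Q 0 x + 4 * Q 2 x" for x
  proof (cases "x \<in> cball 0 1")
    case True
    then have "norm x ^ 2 \<le> 1" by (simp add: power_le_one)
    then have "m x = 1 - norm x ^ 2" by (simp add: m_def dot_square_norm)
    show ?thesis
      unfolding D_def \<open>m x = 1 - norm x ^ 2\<close> using True
          by (simp add: P_def Q_def power2_eq_square power4_eq_xxxx algebra_simps)
  next
    case False
    then have "1 \<le> norm x ^ 2" by (simp add: one_le_power)
    then have "m x = 0" by (simp add: m_def dot_square_norm)
    then show ?thesis using False by (simp add: D_def P_def Q_def)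
  qed
  then have "(LINT x|lborel. D x) = (LINT x|lborel. P 0 x) - 2 * (LINT x|lborel. P 2 x)
      + (LINT x|lborel. P 4 x) - 4 * (LINT x|lborel. Q 0 x) + 4 * (LINT x|lborel. Q 2 x)"
    using intPQ by simp
  then have eq: "(LINT x|lborel. P 0 x) - 2 * (LINT x|lborel. P 2 x) + (LINT x|lborel. P 4 x)
      = 4 * (LINT x|lborel. Q 0 x) - 4 * (LINT x|lborel. Q 2 x)"
    using \<open>(LINT x|lborel. D x) = 0\<close> by linarith
  define A where "A = (LINT x|S2. dir_deriv v F x)"
  define B where "B = (LINT x|S2. G x)"
  have IG: "(LINT x|lborel. Q k x) = B / (k + d + 4)" for k
    using integral_polar[OF cont[OF polyG] homG, of k] by (simp add: B_def Q_def add_ac)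
  show ?thesis
  proof (cases d)
    case 0
    \<comment> \<open>The derivative would be homogeneous of degree \<open>-1\<close>, so polar coordinates do not apply to it.\<close>
    have "dir_deriv v F = (\<lambda>x. 0)" using homogeneous_0_dir_deriv[OF F] hom 0 by auto
    then show ?thesis using eq IG[of 0] IG[of 2] 0 by (simp add: G_def B_def P_def)
  next
    case (Suc e)
    have ID: "(LINT x|lborel. P k x) = A / (k + d + 2)" for k
      using integral_polar[OF cont[OF polyD] homogeneous_dir_deriv[OF F, of e v], of k] hom Suc
          by (simp add: A_def P_def add_ac)
    define a where "a = real d + 2"
    have a: "a > 0" by (simp add: a_def)
    \<comment> \<open>The expansions of \<open>(1 - r\<^sup>2)\<^sup>2\<close> and \<open>4 (1 - r\<^sup>2)\<close> integrated term by term.\<close>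
    have "A / a - 2 * (A / (a + 2)) + A / (a + 4) = 4 * (B / (a + 2)) - 4 * (B / (a + 4))"
      using eq unfolding IG ID by (simp add: a_def add_ac)
    then have "A * 8 / (a * (a + 2) * (a + 4)) = B * 8 / ((a + 2) * (a + 4))"
      using a by (simp add: divide_simps) (simp add: algebra_simps)
    moreover define c where "c = (a + 2) * (a + 4)"
    moreover have "c > 0" using a by (simp add: c_def)
    ultimately have "A * 8 / (a * c) = B * 8 / c" by (simp only: mult.assoc)
    then have "A = a * B" using a \<open>c > 0\<close> by (simp add: divide_simps)
    then show ?thesis by (simp add: A_def B_def G_def a_def)
  qed
qed

section \<open>Harmonic polynomials against zonal polynomials\<close>

definition harmonic_polynomial :: "nat \<Rightarrow> ('a::euclidean_space \<Rightarrow> real) \<Rightarrow> bool" where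
  "harmonic_polynomial l p \<longleftrightarrow>
     real_polynomial_function p \<and> homogeneous l p \<and> (\<forall>x. laplacian p x = 0)"

lemma integrable_S2_polynomial:
  fixes p :: "real^3 \<Rightarrow> real"
  shows "real_polynomial_function p \<Longrightarrow> integrable S2 p"
  using continuous_real_polymonial_function continuous_at_imp_continuous_on integrable_S2_continuous
      by blast

lemma polynomial_inner: "real_polynomial_function (\<lambda>x::'a::real_inner. x \<bullet> v)"
  by (intro real_polynomial_function.intros(1) bounded_linear_inner_left)

lemma polynomial_mult_inner_power:
  fixes p :: "'a::real_inner \<Rightarrow> real"
  shows "real_polynomial_function p \<Longrightarrow> real_polynomial_function (\<lambda>x. p x * (x \<bullet> v) ^ j)"
  by (intro real_polynomial_function.intros(4) real_polynomial_function_power polynomial_inner)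

lemma harmonic_polynomial_dir_deriv:
  "harmonic_polynomial (Suc l) p \<Longrightarrow> harmonic_polynomial l (dir_deriv v p)"
  unfolding harmonic_polynomial_def
  using homogeneous_dir_deriv[of p l v] polynomial_dir_deriv[of p v] laplacian_dir_deriv_commute[of
      p v]
  by (metis dir_deriv_const ext)

text \<open>
  Applying \<open>integral_S2_dir_deriv\<close> to each partial derivative and summing gives the integral
  of the Laplacian on one side and, by Euler's identity, a positive multiple of the integral
  of \<open>p\<close> on the other.
\<close>

lemma integral_S2_harmonic_eq_0:
  fixes p :: "real^3 \<Rightarrow> real"
  assumes "harmonic_polynomial (Suc l) p"
  shows "(LINT x|S2. p x) = 0"
proof -
  from assms have p: "real_polynomial_function p" and h: "homogeneous (Suc l) p"
      and lap: "\<And>x. laplacian p x = 0"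
    by (auto simp: harmonic_polynomial_def)
  have d: "real_polynomial_function (dir_deriv b p)" for b using p by auto
  have int: "integrable S2 (dir_deriv b (dir_deriv b p))" "integrable S2 (\<lambda>x. (x \<bullet> b) * dir_deriv b
      p x)" for b
    by (intro integrable_S2_polynomial polynomial_dir_deriv real_polynomial_function.intros(4)
        polynomial_inner p)+
  have "0 = (LINT x|S2. (\<Sum>b\<in>Basis. dir_deriv b (dir_deriv b p) x))"
    using lap laplacian_dir_deriv[OF p] by simp
  also have "\<dots> = (\<Sum>b\<in>Basis. (l + 2) * (LINT x|S2. (x \<bullet> b) * dir_deriv b p x))"
    using int integral_S2_dir_deriv[OF d homogeneous_dir_deriv[OF p h]] by (simp add: add.commute)
  also have "\<dots> = (l + 2) * (LINT x|S2. (\<Sum>b\<in>Basis. (x \<bullet> b) * dir_deriv b p x))"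
    using int by (simp add: sum_distrib_left)
  also have "\<dots> = (l + 2) * (LINT x|S2. Suc l * p x)"
    using euler_homogeneous[OF p h] by (simp flip: dir_deriv_decompose[OF p])
  finally show ?thesis by simp
qed

text \<open>
  The number \<open>l! / (2 l + 1)!!\<close>. It is the eigenvalue, in the Funk-Hecke formula normalized by
  the area, of the zonal kernel \<open>(x \<bullet> v) ^ l\<close> on harmonics of degree \<open>l\<close>.
\<close>

primrec funk_hecke_const :: "nat \<Rightarrow> real" where
  "funk_hecke_const 0 = 1"
| "funk_hecke_const (Suc l) = real (Suc l) / real (2 * l + 3) * funk_hecke_const l"

text \<open>
  Integration by parts in the direction \<open>v\<close>, applied to \<open>p x * (x \<bullet> v) ^ (j - 1)\<close>. The
  derivative either hits \<open>p\<close>, lowering both the degree and the power by one, or the power,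
  lowering it by two; by induction only the first term survives, and only if \<open>j = l\<close>. There
  Euler's identity at \<open>v\<close> evaluates the derivative of \<open>p\<close>.
\<close>

lemma integral_S2_harmonic_power:
  fixes p :: "real^3 \<Rightarrow> real"
  assumes "harmonic_polynomial l p" "norm v = 1" "j \<le> l"
  shows "(LINT x|S2. p x * (x \<bullet> v) ^ j) =
    (if j = l then area_S2 * funk_hecke_const l * p v else 0)"
  using assms
proof (induction j arbitrary: l p rule: less_induct)
  case (less j)
  from less.prems have p: "real_polynomial_function p" and h: "homogeneous l p"
    by (auto simp: harmonic_polynomial_def)
  show ?case
  proof (cases j)
    case 0
    show ?thesis
    proof (cases l)
      case 0
      have "p x = p v" for x using homogeneous_0_const[OF p] h 0 by metis
      then have "p = (\<lambda>x. p v)" by blast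
      then have "(LINT x|S2. p x) = (LINT x|S2. p v)" by (rule arg_cong)
      then show ?thesis using 0 \<open>j = 0\<close> by simp
    next
      case (Suc k)
      then show ?thesis using integral_S2_harmonic_eq_0[of k p] less.prems 0 by simp
    qed
  next
    case (Suc i)
    then obtain k where k: "l = Suc k" using less.prems by (cases l) auto
    define F where "F = (\<lambda>x. p x * (x \<bullet> v) ^ i)"
    have F: "real_polynomial_function F" using p by (simp add: F_def polynomial_mult_inner_power)
    have hF: "homogeneous (l + i) F"
      unfolding F_def by (intro homogeneous_mult h homogeneous_inner_power)
    have v: "v \<bullet> v = 1" using less.prems by (simp add: dot_square_norm)
    have DF: "dir_deriv v F = (\<lambda>x. dir_deriv v p x * (x \<bullet> v) ^ i + i * (p x * (x \<bullet> v) ^ (i - 1)))"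
      unfolding F_def using p polynomial_inner[of v]
      by (subst dir_deriv_mult)
        (auto simp: dir_deriv_power dir_deriv_bounded_linear[OF bounded_linear_inner_left] v
            fun_eq_iff)
    have 1: "(LINT x|S2. dir_deriv v p x * (x \<bullet> v) ^ i) =
       (if i = k then area_S2 * funk_hecke_const k * dir_deriv v p v else 0)"
      using less.IH[of i k "dir_deriv v p"] harmonic_polynomial_dir_deriv[of k p v] less.prems Suc k
          by auto
    have 2: "real i * (LINT x|S2. p x * (x \<bullet> v) ^ (i - 1)) = 0"
      using less.IH[of "i - 1" l p] less.prems Suc by (cases i) auto
    have "(LINT x|S2. dir_deriv v F x)
        = (LINT x|S2. dir_deriv v p x * (x \<bullet> v) ^ i) + i * (LINT x|S2. p x * (x \<bullet> v) ^ (i - 1))"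
      unfolding DF using p
      by (subst Bochner_Integration.integral_add)
        (auto intro!: integrable_S2_polynomial polynomial_mult_inner_power)
    also have "\<dots> = (if j = l then area_S2 * funk_hecke_const k * (l * p v) else 0)"
      unfolding 1 2 using Suc k euler_homogeneous[OF p h] by simp
    finally have "(l + i + 2) * (LINT x|S2. (x \<bullet> v) * F x) = (if j
        = l then area_S2 * funk_hecke_const k * (l * p v) else 0)"
      using integral_S2_dir_deriv[OF F hF, of v] by (simp add: add.commute add.left_commute)
    also have "(\<lambda>x. (x \<bullet> v) * F x) = (\<lambda>x. p x * (x \<bullet> v) ^ j)"
      by (simp add: F_def Suc mult_ac)
    finally have *: "(l + i + 2) * (LINT x|S2. p x * (x \<bullet> v) ^ j) = (if j
        = l then area_S2 * funk_hecke_const k * (l * p v) else 0)" .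
    show ?thesis
    proof (cases "j = l")
      case True
      then have "real (l + i + 2) = 2 * k + 3" using Suc k by simp
      then show ?thesis using * True k by (simp add: field_simps)
    next
      case False
      then have "real (l + i + 2) * (LINT x|S2. p x * (x \<bullet> v) ^ j) = 0" using * by simp
      then show ?thesis using False by (simp del: of_nat_add)
    qed
  qed
qed

text \<open>
  Only the leading coefficient of \<open>q\<close> counts, since all lower powers are orthogonal to \<open>p\<close>.
\<close>

lemma integral_S2_harmonic_zonal:
  fixes p :: "real^3 \<Rightarrow> real"
  assumes p: "harmonic_polynomial l p" and v: "norm v = 1" and q: "degree q \<le> l"
  shows "(LINT x|S2. p x * poly q (x \<bullet> v)) = area_S2 * funk_hecke_const l * coeff q l * p v"
proof -
  have "poly q y = (\<Sum>j\<le>l. coeff q j * y ^ j)" for y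
    using arg_cong[OF poly_as_sum_of_monoms'[OF q], of "\<lambda>r. poly r y"]
        by (simp add: poly_sum poly_monom)
  then have "(LINT x|S2. p x * poly q (x \<bullet> v)) = (LINT x|S2. (\<Sum>j\<le>l. coeff q j * (p x * (x \<bullet> v) ^ j)))"
    by (simp add: sum_distrib_left mult_ac)
  also have "\<dots> = (\<Sum>j\<le>l. coeff q j * (LINT x|S2. p x * (x \<bullet> v) ^ j))"
    using p
    by (subst Bochner_Integration.integral_sum)
      (auto simp: harmonic_polynomial_def intro!: integrable_S2_polynomial
          polynomial_mult_inner_power)
  also have "\<dots> = (\<Sum>j\<le>l. if j = l then coeff q l * (area_S2 * funk_hecke_const l * p v) else 0)"
    using integral_S2_harmonic_power[OF p v] by (intro sum.cong) auto
  also have "\<dots> = area_S2 * funk_hecke_const l * coeff q l * p v"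
    by simp
  finally show ?thesis .
qed

section \<open>Pointwise bounds for orthonormal harmonics\<close>

text \<open>
  The Chebyshev polynomials of the first kind. Among the polynomials of degree \<open>n\<close> bounded by
  1 on \<open>[-1, 1]\<close> they have the largest leading coefficient, which makes them good test
  functions below.
\<close>

fun chebyshev :: "nat \<Rightarrow> real poly" where
  "chebyshev 0 = 1"
| "chebyshev (Suc 0) = [:0, 1:]"
| "chebyshev (Suc (Suc n)) = [:0, 2:] * chebyshev (Suc n) - chebyshev n"

lemma poly_chebyshev_cos: "poly (chebyshev n) (cos t) = cos (n * t)"
proof (induction n rule: chebyshev.induct)
  case (3 n)
  have "cos (real (Suc (Suc n)) * t) + cos (real n * t) = 2 * cos t * cos (real (Suc n) * t)"
    using cos_plus_cos[of "real (Suc (Suc n)) * t" "real n * t"]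
        by (simp add: algebra_simps add_divide_distrib)
  then show ?case using 3 by simp
qed auto

lemma abs_poly_chebyshev_le_1:
  assumes "\<bar>x\<bar> \<le> 1"
  shows "\<bar>poly (chebyshev n) x\<bar> \<le> 1"
  using poly_chebyshev_cos[of n "arccos x"] assms by (simp add: cos_arccos_abs)

lemma degree_chebyshev: "degree (chebyshev n) \<le> n"
proof (induction n rule: chebyshev.induct)
  case (3 n)
  have "degree ([:0, 2:] * chebyshev (Suc n)) \<le> 1 + Suc n"
    using 3 degree_mult_le[of "[:0, 2:]" "chebyshev (Suc n)"] by simp
  then show ?case using 3 by (auto intro!: degree_diff_le)
qed auto

lemma coeff_chebyshev: "coeff (chebyshev (Suc n)) (Suc n) = 2 ^ n"
proof (induction n)
  case (Suc n)
  have "coeff (chebyshev n) (Suc (Suc n)) = 0"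
    using degree_chebyshev[of n] by (intro coeff_eq_0) simp
  then show ?case using Suc by simp
qed simp

text \<open>
  The integral of the square of \<open>f\<close> minus its orthogonal projection is nonnegative.
\<close>

lemma bessel_S2:
  fixes f :: "real^3 \<Rightarrow> real"
  assumes "finite I" and Y: "\<And>i. i \<in> I \<Longrightarrow> continuous_on (sphere 0 1) (Y i)"
    and orth: "\<And>i j. i \<in> I \<Longrightarrow> j \<in> I \<Longrightarrow> (LINT x|S2. Y i x * Y j x) = (if i = j then 1 else 0)"
    and f: "continuous_on (sphere 0 1) f"
  shows "(\<Sum>i\<in>I. (LINT x|S2. Y i x * f x)\<^sup>2) \<le> (LINT x|S2. (f x)\<^sup>2)"
proof -
  define b where "b i = (LINT x|S2. Y i x * f x)" for i
  have iff: "integrable S2 (\<lambda>x. (f x)\<^sup>2)" by (intro integrable_S2_continuous continuous_intros f)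
  have ifY: "integrable S2 (\<lambda>x. Y i x * f x)" if "i \<in> I" for i
    by (intro integrable_S2_continuous continuous_intros f Y that)
  have iYY: "integrable S2 (\<lambda>x. Y i x * Y j x)" if "i \<in> I" "j \<in> I" for i j
    by (intro integrable_S2_continuous continuous_intros Y that)
  have "0 \<le> (LINT x|S2. (f x - (\<Sum>i\<in>I. b i * Y i x))\<^sup>2)" by simp
  also have "(\<lambda>x. (f x - (\<Sum>i\<in>I. b i * Y i x))\<^sup>2) =
     (\<lambda>x. (f x)\<^sup>2 - 2 * (\<Sum>i\<in>I. b i * (Y i x * f x)) + (\<Sum>i\<in>I. \<Sum>j\<in>I. b i * b j * (Y i x * Y j x)))"
    by (simp add: power2_eq_square algebra_simps sum_distrib_left sum_distrib_right fun_eq_iff)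
  also have "(LINT x|S2. (f x)\<^sup>2 - 2 * (\<Sum>i\<in>I. b i * (Y i x * f x))
      + (\<Sum>i\<in>I. \<Sum>j\<in>I. b i * b j * (Y i x * Y j x)))
     = (LINT x|S2. (f x)\<^sup>2) - 2 * (\<Sum>i\<in>I. b i * b i)
      + (\<Sum>i\<in>I. \<Sum>j\<in>I. b i * b j * (if i = j then 1 else 0))"
    using iff ifY iYY by (simp add: b_def orth)
  also have "(\<Sum>i\<in>I. \<Sum>j\<in>I. b i * b j * (if i = j then 1 else 0)) = (\<Sum>i\<in>I. b i * b i)"
    using \<open>finite I\<close> by (intro sum.cong) (auto simp: if_distrib cong: if_cong)
  finally show ?thesis by (simp add: b_def power2_eq_square)
qed

text \<open>
  The quantity on the right increases with \<open>l\<close> (an estimate of Wallis type), because \<open>(2 l +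
  1) (2 l + 3) \<le> (2 l + 2)\<^sup>2\<close>.
\<close>

lemma funk_hecke_const_lower: "1 \<le> 4 ^ l * (2 * real l + 1) * (funk_hecke_const l)\<^sup>2"
proof (induction l)
  case (Suc l)
  define a b f where "a = real l + 1" and "b = 2 * real l + 3" and "f = funk_hecke_const l"
  have b: "b > 0" "2 * real (Suc l) + 1 = b" by (simp_all add: b_def)
  have f: "funk_hecke_const (Suc l) = a / b * f" by (simp add: a_def b_def f_def add.commute)
  have "(2 * real l + 1) * b \<le> 4 * a\<^sup>2"
    by (simp add: a_def b_def power2_eq_square algebra_simps)
  then have "2 * real l + 1 \<le> 4 * a\<^sup>2 / b"
    using b by (simp add: field_simps)
  then have "4 ^ l * (2 * real l + 1) * f\<^sup>2 \<le> 4 ^ l * (4 * a\<^sup>2 / b) * f\<^sup>2"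
    by (intro mult_left_mono mult_right_mono) auto
  also have "\<dots> = 4 ^ Suc l * b * (a / b * f)\<^sup>2"
    using b(1) by (simp add: power2_eq_square)
  finally show ?case using Suc unfolding f b(2) f_def by linarith
qed simp

text \<open>
  By \<open>integral_S2_harmonic_zonal\<close> the Fourier coefficients of \<open>poly q (x \<bullet> v)\<close> are the numbers
  \<open>Y i v\<close> times a common factor, so this is Bessel's inequality.
\<close>

lemma sum_squares_harmonics_le:
  fixes Y :: "'i \<Rightarrow> real^3 \<Rightarrow> real"
  assumes I: "finite I" and Y: "\<And>i. i \<in> I \<Longrightarrow> spherical_harmonic l (Y i)"
    and orth: "\<And>i j. i \<in> I \<Longrightarrow> j \<in> I \<Longrightarrow> (LINT x|S2. Y i x * Y j x) = (if i = j then 1 else 0)"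
    and v: "norm v = 1" and q: "degree q \<le> l"
  shows "(area_S2 * funk_hecke_const l * coeff q l)\<^sup>2 * (\<Sum>i\<in>I. (Y i v)\<^sup>2)
      \<le> (LINT x|S2. (poly q (x \<bullet> v))\<^sup>2)"
proof -
  have "\<exists>p. harmonic_polynomial l p \<and> (\<forall>v\<in>sphere 0 1. Y i v = p v)" if "i \<in> I" for i
    using Y[OF that] unfolding spherical_harmonic_def harmonic_polynomial_def homogeneous_def by blast
  then obtain p where p: "\<And>i. i \<in> I \<Longrightarrow> harmonic_polynomial l (p i)"
    and Yp: "\<And>i x. i \<in> I \<Longrightarrow> x \<in> sphere 0 1 \<Longrightarrow> Y i x = p i x" by metis
  have cont: "continuous_on S (p i)" if "i \<in> I" for i S
    using p[OF that] continuous_real_polymonial_function continuous_at_imp_continuous_on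
    unfolding harmonic_polynomial_def by blast
  have orth': "(LINT x|S2. p i x * p j x) = (if i = j then 1 else 0)" if "i \<in> I" "j \<in> I" for i j
    unfolding orth[OF that, symmetric]
    by (intro Bochner_Integration.integral_cong) (auto simp: space_S2 Yp that)
  have "(\<Sum>i\<in>I. (LINT x|S2. p i x * poly q (x \<bullet> v))\<^sup>2) \<le> (LINT x|S2. (poly q (x \<bullet> v))\<^sup>2)"
    by (rule bessel_S2[OF I cont orth']) (auto intro!: continuous_intros)
  also have "(\<Sum>i\<in>I. (LINT x|S2. p i x * poly q (x \<bullet> v))\<^sup>2)
      = (\<Sum>i\<in>I. (area_S2 * funk_hecke_const l * coeff q l)\<^sup>2 * (Y i v)\<^sup>2)"
    using v by (intro sum.cong) (simp_all add: integral_S2_harmonic_zonal[OF p v q] Yp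
        flip: power_mult_distrib)
  finally show ?thesis by (simp add: sum_distrib_left)
qed

text \<open>
  The test polynomial is \<open>chebyshev l\<close>. For \<open>l \<le> 1\<close> it is the Legendre polynomial, its square
  is integrated exactly, and the result is the bound of the addition theorem, \<open>(2 l + 1) /
  area_S2\<close>. For larger \<open>l\<close> its square is estimated by 1, at the price of the factor 4.
\<close>

lemma sum_squares_harmonics_degree_le:
  fixes Y :: "'i \<Rightarrow> real^3 \<Rightarrow> real"
  assumes I: "finite I" and Y: "\<And>i. i \<in> I \<Longrightarrow> spherical_harmonic l (Y i)"
    and orth: "\<And>i j. i \<in> I \<Longrightarrow> j \<in> I \<Longrightarrow> (LINT x|S2. Y i x * Y j x) = (if i = j then 1 else 0)"
    and v: "norm v = 1"
  shows "(\<Sum>i\<in>I. (Y i v)\<^sup>2) \<le> (if l \<le> 1 then 1 else 4) * (2 * real l + 1) / area_S2"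
proof -
  have A: "area_S2 > 0" by (simp add: area_S2_eq)
  note main = sum_squares_harmonics_le[OF I Y orth v degree_chebyshev[of l]]
  consider "l = 0" | "l = 1" | k where "l = Suc k" "l > 1" by (cases l; force)
  then show ?thesis
  proof cases
    case 1
    then have "area_S2 * (area_S2 * (\<Sum>i\<in>I. (Y i v)\<^sup>2)) \<le> area_S2 * 1"
      using main by (simp add: power2_eq_square mult.assoc)
    then show ?thesis using A 1 by (simp add: field_simps)
  next
    case 2
    have "(LINT x|S2. (x \<bullet> v)\<^sup>2) = area_S2 / 3"
    proof -
      have "dir_deriv v (\<lambda>x. x \<bullet> v) = (\<lambda>x. 1)"
        using v by (simp add: dir_deriv_bounded_linear[OF bounded_linear_inner_left] dot_square_norm)
      then show ?thesis
        using integral_S2_dir_deriv[OF polynomial_inner homogeneous_inner, of v v]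
            by (simp add: power2_eq_square)
    qed
    then have "area_S2 / 3 * (area_S2 / 3 * (\<Sum>i\<in>I. (Y i v)\<^sup>2)) \<le> area_S2 / 3 * 1"
      using main 2 by (simp add: power2_eq_square mult.assoc)
    then show ?thesis using A 2 by (simp add: field_simps)
  next
    case 3
    define S where "S = (\<Sum>i\<in>I. (Y i v)\<^sup>2)"
    have "(LINT x|S2. (poly (chebyshev l) (x \<bullet> v))\<^sup>2) \<le> (LINT x|S2. 1)"
    proof (rule integral_mono)
      show "integrable S2 (\<lambda>x. (poly (chebyshev l) (x \<bullet> v))\<^sup>2)"
        by (intro integrable_S2_continuous continuous_intros)
      show "integrable S2 (\<lambda>x. 1 :: real)" by (intro integrable_S2_continuous continuous_intros)
      fix x assume "x \<in> space S2"
      then have "\<bar>x \<bullet> v\<bar> \<le> 1" using Cauchy_Schwarz_ineq2[of x v] v by (simp add: space_S2)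
      then show "(poly (chebyshev l) (x \<bullet> v))\<^sup>2 \<le> 1"
        using abs_poly_chebyshev_le_1 by (simp add: abs_square_le_1)
    qed
    then have bound: "(area_S2 * funk_hecke_const l * 2 ^ k)\<^sup>2 * S \<le> area_S2"
      using main 3 by (simp add: coeff_chebyshev S_def)
    define f W where "f = funk_hecke_const l" and "W = area_S2 * f\<^sup>2 * 4 ^ l"
    have "4 * (2 ^ k)\<^sup>2 = (4::real) ^ l"
      using 3 by (simp add: power2_eq_square flip: power_mult_distrib)
    then have "area_S2 * W = 4 * (area_S2 * f * 2 ^ k)\<^sup>2"
      unfolding W_def by (simp add: power_mult_distrib power2_eq_square)
    then have "area_S2 * (W * S) = 4 * ((area_S2 * f * 2 ^ k)\<^sup>2 * S)"
      by (simp only: mult.assoc[symmetric])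
    also have "\<dots> \<le> 4 * area_S2"
      using bound unfolding f_def by (intro mult_left_mono) auto
    finally have "W * S \<le> 4" using A by (simp add: mult.commute)
    then have *: "(2 * real l + 1) * (W * S) \<le> (2 * real l + 1) * 4"
      by (intro mult_left_mono) auto
    have "1 * (area_S2 * S) \<le> (4 ^ l * (2 * real l + 1) * f\<^sup>2) * (area_S2 * S)"
      unfolding f_def using A by (intro mult_right_mono funk_hecke_const_lower) (auto simp: S_def
          sum_nonneg)
    also have "\<dots> = (2 * real l + 1) * (W * S)" by (simp add: W_def)
    finally have "area_S2 * S \<le> 4 * (2 * real l + 1)" using * by linarith
    then show ?thesis using A 3 by (simp add: S_def field_simps)
  qed
qed

text \<open>
  Adding the bounds for the single degrees: degrees 0 and 1 contribute 1 and 3, every degree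
  \<open>l \<ge> 2\<close> contributes \<open>4 (2 l + 1)\<close>.
\<close>

lemma sum_squares_real_spherical_harmonics:
  assumes Y: "real_spherical_harmonics N Y" and v: "norm v = 1" and N: "N \<ge> 1"
  shows "(\<Sum>i<(N + 1)\<^sup>2. (Y i v)\<^sup>2) \<le> (4 * (real N + 1)\<^sup>2 - 12) / area_S2"
proof -
  define B where "B l = {l\<^sup>2..<(l + 1)\<^sup>2}" for l :: nat
  have blk: "(\<Sum>i\<in>B l. (Y i v)\<^sup>2) \<le> (if l \<le> 1 then 1 else 4) * (2 * real l + 1) / area_S2" if "l \<le> N"
      for l
  proof (rule sum_squares_harmonics_degree_le[OF _ _ _ v])
    have le: "(l + 1)\<^sup>2 \<le> (N + 1)\<^sup>2" using that by (intro power_mono) auto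
    show "(LINT x|S2. Y i x * Y j x) = (if i = j then 1 else 0)" if "i \<in> B l" "j \<in> B l" for i j
    proof -
      have "i < (N + 1)\<^sup>2" "j < (N + 1)\<^sup>2" using that le unfolding B_def atLeastLessThan_iff
          by linarith+
      then show ?thesis using Y unfolding real_spherical_harmonics_def by blast
    qed
    show "spherical_harmonic l (Y i)" if "i \<in> B l" for i
      using Y that \<open>l \<le> N\<close> unfolding real_spherical_harmonics_def B_def by blast
  qed (simp add: B_def)
  have split: "(\<Sum>i<(l + 1)\<^sup>2. (Y i v)\<^sup>2) = (\<Sum>i<l\<^sup>2. (Y i v)\<^sup>2) + (\<Sum>i\<in>B l. (Y i v)\<^sup>2)" for l
  proof -
    have "{..<(l + 1)\<^sup>2} = {..<l\<^sup>2} \<union> B l" unfolding B_def by (auto simp: power2_eq_square)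
    then show ?thesis by (simp add: sum.union_disjoint B_def disjoint_iff)
  qed
  have "M \<le> N \<Longrightarrow> (\<Sum>i<(M + 1)\<^sup>2. (Y i v)\<^sup>2) \<le> (4 * (real M + 1)\<^sup>2 - 12) / area_S2" if "M \<ge> 1" for M
    using that
  proof (induction M rule: dec_induct)
    case base
    have "(\<Sum>i<(1 + 1)\<^sup>2. (Y i v)\<^sup>2) = (\<Sum>i\<in>B 0. (Y i v)\<^sup>2) + (\<Sum>i\<in>B 1. (Y i v)\<^sup>2)"
      using split[of 0] split[of 1] by simp
    then show ?case using blk[of 0] blk[of 1] base by (simp add: field_simps)
  next
    case (step M)
    have "(\<Sum>i<(Suc M + 1)\<^sup>2. (Y i v)\<^sup>2)
        \<le> (4 * (real M + 1)\<^sup>2 - 12) / area_S2 + 4 * (2 * real (Suc M) + 1) / area_S2"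
      unfolding split using step blk[of "Suc M"] by (intro add_mono) auto
    also have "\<dots> = (4 * (real (Suc M) + 1)\<^sup>2 - 12) / area_S2"
      unfolding add_divide_distrib[symmetric] by (simp add: power2_eq_square algebra_simps)
    finally show ?case .
  qed
  from this[OF N] show ?thesis by simp
qed

text \<open>
  Converts the bound on the sum of squares into the form needed in the final estimate. It is
  applied to \<open>a = area_S2 = 4 \<pi>\<close>, and 16 is the largest \<open>a\<close> that the case \<open>N = 1\<close> admits.
\<close>

lemma area_times_harmonics_bound:
  fixes a :: real
  assumes N: "N \<ge> (1::nat)" and a: "a \<le> 16"
  shows "a * (4 * (real N + 1)\<^sup>2 - 12) \<le> ((real N + 1)\<^sup>2) ^ 3"
proof -
  define s where "s = (real N + 1)\<^sup>2"
  have s: "s = 4 \<or> s \<ge> 9"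
  proof (cases "N = 1")
    case False
    then have "(3::real)\<^sup>2 \<le> (real N + 1)\<^sup>2" using N by (intro power_mono) auto
    then show ?thesis by (simp add: s_def)
  qed (simp add: s_def)
  then have "16 * (4 * s - 12) \<le> s ^ 3"
  proof
    assume "s \<ge> 9"
    then have "9 * 9 * s \<le> s * s * s" by (intro mult_mono) auto
    moreover have "16 * (4 * s - 12) \<le> 9 * 9 * s" using \<open>s \<ge> 9\<close> by simp
    ultimately show ?thesis by (simp add: power3_eq_cube)
  qed simp
  moreover have "a * (4 * s - 12) \<le> 16 * (4 * s - 12)"
    using a s by (intro mult_right_mono) auto
  ultimately show ?thesis by (simp add: s_def)
qed

text \<open>
  The bound is chosen such that multiplying it by \<open>sqrt area_S2\<close> gives \<open>real (n + 1) * sqrt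
  (real (n + 1) / area_S2)\<close>.
\<close>

lemma norm_harmonics_vector_le:
  fixes idx :: "'n::finite \<Rightarrow> nat"
  assumes Y: "real_spherical_harmonics N Y" and idx: "bij_betw idx UNIV {1..n}"
    and n: "n + 1 = (N + 1)\<^sup>2" and N: "N \<ge> 1" and v: "norm v = 1"
  shows "norm (harmonics_vector Y idx v) \<le> sqrt (real (n + 1) ^ 3) / area_S2"
proof -
  have A: "area_S2 > 0" "area_S2 \<le> 16" using pi_less_4 by (auto simp: area_S2_eq)
  have rn: "real (n + 1) = (real N + 1)\<^sup>2" unfolding n by (simp add: add.commute)
  have "(norm (harmonics_vector Y idx v))\<^sup>2 = (Y 0 v)\<^sup>2 + (\<Sum>k\<in>UNIV. (Y (idx k) v)\<^sup>2)"
    by (simp add: harmonics_vector_def norm_Pair norm_vec_def L2_set_def sum_nonneg)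
  also have "(\<Sum>k\<in>UNIV. (Y (idx k) v)\<^sup>2) = (\<Sum>i\<in>{1..n}. (Y i v)\<^sup>2)"
    by (rule sum.reindex_bij_betw[OF idx])
  also have "(Y 0 v)\<^sup>2 + \<dots> = (\<Sum>i<(N + 1)\<^sup>2. (Y i v)\<^sup>2)"
  proof -
    have "{..<(N + 1)\<^sup>2} = insert 0 {1..n}" unfolding n[symmetric] by auto
    then show ?thesis by simp
  qed
  also have "\<dots> \<le> (4 * (real N + 1)\<^sup>2 - 12) / area_S2"
    by (rule sum_squares_real_spherical_harmonics[OF Y v N])
  also have "\<dots> = (area_S2 * (4 * (real N + 1)\<^sup>2 - 12)) / area_S2\<^sup>2"
    using A by (simp add: power2_eq_square)
  also have "\<dots> \<le> real (n + 1) ^ 3 / area_S2\<^sup>2"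
    unfolding rn by (intro divide_right_mono area_times_harmonics_bound[OF N A(2)]) auto
  also have "\<dots> = (sqrt (real (n + 1) ^ 3) / area_S2)\<^sup>2"
    by (simp add: power_divide)
  finally show ?thesis
    by (rule power2_le_imp_le) simp
qed

section \<open>Minimizers of the regularized dual\<close>

text \<open>
  For negative \<open>x\<close> this follows from \<open>exp x \<le> 1 / (1 - x)\<close>.
\<close>

lemma exp_le_quadratic:
  fixes x :: real
  assumes "\<bar>x\<bar> \<le> 1"
  shows "exp x - 1 - x \<le> x\<^sup>2"
proof (cases "x \<ge> 0")
  case True
  then show ?thesis using exp_bound[of x] assms by simp
next
  case False
  have "exp x * (1 - x) \<le> exp x * exp (- x)"
    using exp_ge_add_one_self[of "- x"] by (intro mult_left_mono) auto
  also have "\<dots> = 1" by (simp flip: exp_add)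
  also have "1 \<le> (1 + x + x\<^sup>2) * (1 - x)"
    using mult_nonpos_nonneg[of x "x\<^sup>2"] False by (simp add: algebra_simps power2_eq_square)
  finally have "exp x \<le> 1 + x + x\<^sup>2" using False by (simp add: mult_le_cancel_right)
  then show ?thesis by simp
qed

text \<open>
  The functions \<open>g ln g - g\<close> and \<open>exp\<close> are convex conjugates of each other.
\<close>

lemma fenchel_young_entropy:
  fixes g x :: real
  assumes "g \<ge> 0"
  shows "g * x - exp x \<le> g * ln g - g"
proof (cases "g = 0")
  case False
  then have g: "g > 0" using assms by simp
  have "g * (1 + (x - ln g)) \<le> g * exp (x - ln g)"
    using g exp_ge_add_one_self by (intro mult_left_mono) auto
  also have "\<dots> = exp x" using g by (simp add: exp_diff)
  finally show ?thesis by (simp add: algebra_simps)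
qed simp

lemma arg_min_minimizes:
  fixes f :: "'a \<Rightarrow> real"
  assumes "\<And>y. f x \<le> f y"
  shows "f (arg_min f (\<lambda>_. True)) \<le> f y"
  by (rule arg_minI[where P = "\<lambda>_. True" and x = x and f = f]) (use assms in \<open>auto simp: not_less\<close>)

text \<open>
  The duality theory uses no more about the vector of harmonics than that it is bounded and
  measurable and that its zeroth entry is the constant \<open>1 / sqrt area_S2\<close>.
\<close>

locale moment_map =
  fixes m :: "real^3 \<Rightarrow> real \<times> (real^'n)" and K :: real
  assumes m_measurable [measurable]: "m \<in> borel_measurable S2"
    and m_bound: "\<And>v. v \<in> sphere 0 1 \<Longrightarrow> norm (m v) \<le> K"
    and fst_m: "\<And>v. v \<in> sphere 0 1 \<Longrightarrow> fst (m v) = 1 / sqrt area_S2"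
begin

definition m0 :: real where "m0 = 1 / sqrt area_S2"

definition partition_fn :: "real^'n \<Rightarrow> real" where "partition_fn \<beta> = (LINT v|S2. exp (\<beta> \<bullet> snd (m v)))"

lemma m0_pos: "m0 > 0"
  by (simp add: m0_def area_S2_eq)

lemma K_pos: "K > 0"
proof -
  obtain v :: "real^3" where v: "v \<in> sphere 0 1" using vector_choose_size[of 1] by auto
  have "norm (fst (m v)) \<le> norm (m v)" using norm_fst_le[of "fst (m v)" "snd (m v)"] by simp
  moreover have "fst (m v) = m0" using fst_m[OF v] by (simp add: m0_def)
  ultimately have "m0 \<le> norm (m v)" by simp
  then show ?thesis using m_bound[OF v] m0_pos by linarith
qed

lemma fst_m0: "v \<in> sphere 0 1 \<Longrightarrow> fst (m v) = m0"
  by (simp add: fst_m m0_def)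

lemma inner_m_bound: "v \<in> sphere 0 1 \<Longrightarrow> \<bar>\<alpha> \<bullet> m v\<bar> \<le> norm \<alpha> * K"
  using Cauchy_Schwarz_ineq2[of \<alpha> "m v"] mult_left_mono[OF m_bound, of v "norm \<alpha>"] by auto

lemma inner_snd_m_bound: "v \<in> sphere 0 1 \<Longrightarrow> \<bar>\<beta> \<bullet> snd (m v)\<bar> \<le> norm \<beta> * K"
  using inner_m_bound[of v "(0, \<beta>)"] by (simp add: inner_prod_def norm_Pair)

lemma integrable_exp: "integrable S2 (\<lambda>v. exp (\<alpha> \<bullet> m v))"
proof (rule integrable_S2I[where B = "exp (norm \<alpha> * K)"])
  show "norm (exp (\<alpha> \<bullet> m v)) \<le> exp (norm \<alpha> * K)" if "v \<in> sphere 0 1" for v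
    using inner_m_bound[OF that, of \<alpha>] by simp
qed measurable

lemma integrable_exp_snd: "integrable S2 (\<lambda>v. exp (\<beta> \<bullet> snd (m v)))"
  using integrable_exp[of "(0, \<beta>)"] by (simp add: inner_prod_def)

lemma integrable_exp_m: "integrable S2 (\<lambda>v. exp (\<alpha> \<bullet> m v) *\<^sub>R m v)"
proof (rule integrable_S2I[where B = "exp (norm \<alpha> * K) * K"])
  show "norm (exp (\<alpha> \<bullet> m v) *\<^sub>R m v) \<le> exp (norm \<alpha> * K) * K" if "v \<in> sphere 0 1" for v
    using inner_m_bound[OF that, of \<alpha>] m_bound[OF that] by (auto intro!: mult_mono)
qed measurable

lemma inner_moments: "\<delta> \<bullet> moments m (ansatz m \<alpha>) = (LINT v|S2. exp (\<alpha> \<bullet> m v) * (\<delta> \<bullet> m v))"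
  using integral_inner_right[of \<delta> S2 "\<lambda>v. exp (\<alpha> \<bullet> m v) *\<^sub>R m v"] integrable_exp_m
  by (simp add: moments_def ansatz_def)

lemma integral_S2_cong: "(\<And>v. v \<in> sphere 0 1 \<Longrightarrow> f v = g v) \<Longrightarrow> integral\<^sup>L S2 f = integral\<^sup>L S2 g"
  by (rule Bochner_Integration.integral_cong) (auto simp: space_S2)

lemma integral_exp: "(LINT v|S2. exp ((a, \<beta>) \<bullet> m v)) = exp (m0 * a) * partition_fn \<beta>"
proof -
  have "(LINT v|S2. exp ((a, \<beta>) \<bullet> m v)) = (LINT v|S2. exp (m0 * a) * exp (\<beta> \<bullet> snd (m v)))"
    by (rule integral_S2_cong) (simp add: inner_prod_def fst_m0 exp_add mult.commute)
  then show ?thesis by (simp add: partition_fn_def)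
qed

lemma partition_fn_pos: "partition_fn \<beta> > 0"
proof -
  have "0 < exp (- (norm \<beta> * K)) * area_S2" by (simp add: area_S2_eq)
  also have "\<dots> = (LINT v|S2. exp (- (norm \<beta> * K)))" by simp
  also have "\<dots> \<le> partition_fn \<beta>"
    unfolding partition_fn_def
  proof (rule integral_mono[OF _ integrable_exp_snd])
    show "exp (- (norm \<beta> * K)) \<le> exp (\<beta> \<bullet> snd (m v))" if "v \<in> space S2" for v
      using inner_snd_m_bound[of v \<beta>] that by (simp add: space_S2)
  qed (rule integrable_S2I[where B = 1], auto simp: K_pos less_imp_le)
  finally show ?thesis .
qed

text \<open>
  Thus \<open>ln \<circ> partition_fn\<close> is Lipschitz with constant \<open>K\<close>. This yields both continuity and
  coercivity of \<open>phi_hat\<close>, without differentiating under the integral.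
\<close>

lemma partition_fn_ratio_le: "partition_fn \<beta>' \<le> exp (norm (\<beta>' - \<beta>) * K) * partition_fn \<beta>"
proof -
  have "partition_fn \<beta>' \<le> (LINT v|S2. exp (norm (\<beta>' - \<beta>) * K) * exp (\<beta> \<bullet> snd (m v)))"
    unfolding partition_fn_def
  proof (rule integral_mono[OF integrable_exp_snd])
    show "exp (\<beta>' \<bullet> snd (m v)) \<le> exp (norm (\<beta>' - \<beta>) * K) * exp (\<beta> \<bullet> snd (m v))" if "v \<in> space S2"
        for v
      using inner_snd_m_bound[of v "\<beta>' - \<beta>"] that
          by (simp add: space_S2 inner_diff_left flip: exp_add)
  qed (simp add: integrable_exp_snd)
  then show ?thesis by (simp add: partition_fn_def)
qed

lemma theta_partition_fn: "theta m \<beta> = - ((ln m0 + ln (partition_fn \<beta>)) / m0)"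
  unfolding theta_def partition_fn_def[symmetric] m0_def[symmetric] Let_def by simp

lemma theta_lipschitz: "\<bar>theta m \<beta>' - theta m \<beta>\<bar> \<le> K / m0 * norm (\<beta>' - \<beta>)"
proof -
  have le: "ln (partition_fn \<beta>') - ln (partition_fn \<beta>) \<le> norm (\<beta>' - \<beta>) * K" for \<beta> \<beta>'
    using partition_fn_ratio_le[of \<beta>' \<beta>] partition_fn_pos[of \<beta>] partition_fn_pos[of \<beta>'] ln_mono[of
        "partition_fn \<beta>'" "exp (norm (\<beta>' - \<beta>) * K) * partition_fn \<beta>"]
    by (simp add: ln_mult)
  have "theta m \<beta>' - theta m \<beta> = (ln (partition_fn \<beta>) - ln (partition_fn \<beta>')) / m0"
    by (simp add: theta_partition_fn diff_divide_distrib add_divide_distrib)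
  then show ?thesis
    using le[of \<beta>' \<beta>] le[of \<beta> \<beta>'] m0_pos
        by (simp add: norm_minus_commute abs_le_iff divide_simps mult.commute)
qed

lemma phi_partition_fn:
  "phi m \<gamma> u (a, \<beta>)
      = exp (m0 * a) * partition_fn \<beta> - a * fst u - \<beta> \<bullet> snd u + fst u * \<gamma> / 2 * (norm \<beta>)\<^sup>2"
  unfolding phi_def integral_exp by (simp add: inner_prod_def)

text \<open>
  At \<open>a = theta m \<beta>\<close> the zeroth moment \<open>m0 * exp (m0 * a) * partition_fn \<beta>\<close> equals 1.
\<close>

lemma exp_theta: "exp (m0 * theta m \<beta>) * partition_fn \<beta> = 1 / m0"
  using m0_pos partition_fn_pos[of \<beta>]
      by (simp add: theta_partition_fn exp_diff exp_minus divide_simps)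

lemma phi_hat_theta: "phi_hat m \<gamma> w \<beta> = 1 / m0 - theta m \<beta> - \<beta> \<bullet> w + \<gamma> / 2 * (norm \<beta>)\<^sup>2"
  unfolding phi_hat_def phi_partition_fn exp_theta by simp

text \<open>
  The variable \<open>r\<close> measures how far the zeroth multiplier is from the optimal one for the
  given \<open>\<beta>\<close>; it enters through \<open>exp r - 1 - r\<close>, which is nonnegative and vanishes only at 0.
\<close>

lemma phi_reduced:
  assumes u: "fst u > 0"
  shows "phi m \<gamma> u (theta m \<beta> + (ln (fst u) + r) / m0, \<beta>) =
    fst u * phi_hat m \<gamma> (snd u /\<^sub>R fst u) \<beta> + fst u / m0 * (exp r - 1 - r - ln (fst u))"
proof -
  have "exp (m0 * (theta m \<beta> + (ln (fst u) + r) / m0)) * partition_fn \<beta> =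
      exp (ln (fst u) + r) * (exp (m0 * theta m \<beta>) * partition_fn \<beta>)"
  proof -
    have "m0 * (theta m \<beta> + (ln (fst u) + r) / m0) = (ln (fst u) + r) + m0 * theta m \<beta>"
      using m0_pos by (simp add: distrib_left[of m0 "theta m \<beta>"])
    then show ?thesis by (simp only: exp_add mult.assoc)
  qed
  also have "\<dots> = fst u * exp r / m0" unfolding exp_theta using u by (simp add: exp_add)
  finally show ?thesis
    unfolding phi_partition_fn phi_hat_theta using m0_pos u by (simp add: field_simps)
qed

text \<open>
  A Lipschitz function plus a linear one plus a positive multiple of the squared norm: outside
  a large ball no value is below the one at 0, and on the ball the minimum is attained.
\<close>

lemma phi_hat_has_minimizer:
  assumes "\<gamma> > 0"
  obtains \<beta> where "\<And>\<beta>'. phi_hat m \<gamma> w \<beta> \<le> phi_hat m \<gamma> w \<beta>'"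
proof -
  define \<kappa> where "\<kappa> = K / m0"
  have \<kappa>: "\<kappa> > 0" using K_pos m0_pos by (simp add: \<kappa>_def)
  note lip = theta_lipschitz[folded \<kappa>_def]
  \<comment> \<open>For \<open>norm \<beta> > R\<close> the quadratic term outweighs the Lipschitz and the linear term.\<close>
  define R where "R = 2 * (\<kappa> + norm w) / \<gamma>"
  have R: "R \<ge> 0" using assms \<kappa> by (simp add: R_def)
  have "continuous_on S (theta m)" for S
    by (rule lipschitz_on_continuous_on[of "\<kappa>"])
      (use lip \<kappa> in \<open>auto intro!: lipschitz_onI simp: dist_norm\<close>)
  then have cont: "continuous_on (cball 0 R) (phi_hat m \<gamma> w)"
    unfolding phi_hat_theta[abs_def] by (intro continuous_intros)
  obtain \<beta> where \<beta>: "\<And>\<beta>'. \<beta>' \<in> cball 0 R \<Longrightarrow> phi_hat m \<gamma> w \<beta> \<le> phi_hat m \<gamma> w \<beta>'"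
    using continuous_attains_inf[OF _ _ cont] R by (metis centre_in_cball compact_cball empty_iff)
  have out: "phi_hat m \<gamma> w 0 \<le> phi_hat m \<gamma> w \<beta>'" if "\<beta>' \<notin> cball 0 R" for \<beta>'
  proof -
    have "\<beta>' \<bullet> w \<le> norm \<beta>' * norm w" by (rule norm_cauchy_schwarz)
    moreover have "theta m \<beta>' - theta m 0 \<le> \<kappa> * norm \<beta>'" using lip[of \<beta>' 0] by simp
    moreover have "(\<kappa> + norm w) * norm \<beta>' \<le> \<gamma> / 2 * (norm \<beta>')\<^sup>2"
    proof -
      have "\<kappa> + norm w = \<gamma> / 2 * R" using assms by (simp add: R_def)
      also have "\<dots> \<le> \<gamma> / 2 * norm \<beta>'" using that assms by (intro mult_left_mono) auto
      finally have "(\<kappa> + norm w) * norm \<beta>' \<le> (\<gamma> / 2 * norm \<beta>') * norm \<beta>'"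
          by (intro mult_right_mono) auto
      then show ?thesis by (simp add: power2_eq_square mult.assoc)
    qed
    ultimately show ?thesis unfolding phi_hat_theta by (simp add: algebra_simps)
  qed
  have "phi_hat m \<gamma> w \<beta> \<le> phi_hat m \<gamma> w \<beta>'" for \<beta>'
    using \<beta>[of \<beta>'] \<beta>[of 0] out[of \<beta>'] R by (cases "\<beta>' \<in> cball 0 R") auto
  then show ?thesis by (rule that)
qed

lemma beta_opt_minimizes:
  assumes "\<gamma> > 0"
  shows "phi_hat m \<gamma> w (beta_opt m \<gamma> w) \<le> phi_hat m \<gamma> w \<beta>"
proof -
  obtain \<beta>0 where "\<And>\<beta>'. phi_hat m \<gamma> w \<beta>0 \<le> phi_hat m \<gamma> w \<beta>'"
    using phi_hat_has_minimizer[OF assms] by blast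
  then show ?thesis unfolding beta_opt_def by (rule arg_min_minimizes)
qed

text \<open>
  The gradient of \<open>phi m \<gamma> u\<close> at \<open>\<alpha>\<close>.
\<close>

definition dual_gradient :: "real \<Rightarrow> real \<times> (real^'n) \<Rightarrow> real \<times> (real^'n) \<Rightarrow> real \<times> (real^'n)" where
  "dual_gradient \<gamma> u \<alpha> = moments m (ansatz m \<alpha>) - u + (fst u * \<gamma>) *\<^sub>R (0, snd \<alpha>)"

text \<open>
  Exact second-order expansion: the integral is the remainder of the exponential beyond its
  linear part. Bounded above it yields the first-order condition, bounded below convexity.
\<close>

lemma phi_expand:
  "phi m \<gamma> u (\<alpha> + \<delta>) = phi m \<gamma> u \<alpha> + \<delta> \<bullet> dual_gradient \<gamma> u \<alpha>
     + (LINT v|S2. exp (\<alpha> \<bullet> m v) * (exp (\<delta> \<bullet> m v) - 1 - \<delta> \<bullet> m v))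
     + fst u * \<gamma> / 2 * (norm (snd \<delta>))\<^sup>2"
proof -
  have i: "integrable S2 (\<lambda>v. exp (\<alpha> \<bullet> m v) * (\<delta> \<bullet> m v))"
    using integrable_inner_right[OF integrable_exp_m, of \<delta> \<alpha>] by simp
  have "(LINT v|S2. exp (\<alpha> \<bullet> m v) * (exp (\<delta> \<bullet> m v) - 1 - \<delta> \<bullet> m v)) =
      (LINT v|S2. exp ((\<alpha> + \<delta>) \<bullet> m v) - exp (\<alpha> \<bullet> m v) - exp (\<alpha> \<bullet> m v) * (\<delta> \<bullet> m v))"
    by (intro integral_S2_cong) (simp add: inner_add_left exp_add algebra_simps)
  also have "\<dots> = (LINT v|S2. exp ((\<alpha> + \<delta>) \<bullet> m v)) - (LINT v|S2. exp (\<alpha> \<bullet> m v))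
      - \<delta> \<bullet> moments m (ansatz m \<alpha>)"
    using integrable_exp i by (simp add: inner_moments)
  finally have 1: "(LINT v|S2. exp ((\<alpha> + \<delta>) \<bullet> m v))
      = (LINT v|S2. exp (\<alpha> \<bullet> m v)) + \<delta> \<bullet> moments m (ansatz m \<alpha>)
      + (LINT v|S2. exp (\<alpha> \<bullet> m v) * (exp (\<delta> \<bullet> m v) - 1 - \<delta> \<bullet> m v))" by simp
  have 2: "(norm (snd (\<alpha> + \<delta>)))\<^sup>2 = (norm (snd \<alpha>))\<^sup>2 + 2 * (snd \<delta> \<bullet> snd \<alpha>) + (norm (snd \<delta>))\<^sup>2"
    by (simp add: power2_norm_eq_inner inner_add_left inner_add_right inner_commute)
  have 3: "\<delta> \<bullet> dual_gradient \<gamma> u \<alpha> = \<delta> \<bullet> moments m (ansatz m \<alpha>) - \<delta> \<bullet> u + fst u * \<gamma> * (snd \<delta> \<bullet> snd \<alpha>)"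
    by (simp add: dual_gradient_def inner_add_right inner_diff_right inner_prod_def
        right_diff_distrib)
  show ?thesis
    unfolding phi_def 1 2 3 by (simp add: inner_add_left algebra_simps)
qed

lemma integrable_remainder: "integrable S2 (\<lambda>v. exp (\<alpha> \<bullet> m v) * (exp (\<delta> \<bullet> m v) - 1 - \<delta> \<bullet> m v))"
proof -
  have "integrable S2 (\<lambda>v. exp (\<alpha> \<bullet> m v) * (\<delta> \<bullet> m v))"
    using integrable_inner_right[OF integrable_exp_m, of \<delta> \<alpha>] by simp
  then have "integrable S2 (\<lambda>v. exp ((\<alpha> + \<delta>) \<bullet> m v) - exp (\<alpha> \<bullet> m v) - exp (\<alpha> \<bullet> m v) * (\<delta> \<bullet> m v))"
    using integrable_exp by simp
  then show ?thesis by (simp add: inner_add_left exp_add algebra_simps)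
qed

text \<open>
  A short step against a nonzero gradient would decrease \<open>phi\<close>: the linear term is of the
  order of the step length and the remainder of the order of its square.
\<close>

lemma dual_gradient_eq_0:
  assumes min: "\<And>\<alpha>'. phi m \<gamma> u \<alpha> \<le> phi m \<gamma> u \<alpha>'"
  shows "dual_gradient \<gamma> u \<alpha> = 0"
proof (rule ccontr)
  define G where "G = dual_gradient \<gamma> u \<alpha>"
  assume "dual_gradient \<gamma> u \<alpha> \<noteq> 0"
  then have G: "norm G > 0" by (simp add: G_def)
  define D where "D = norm G * K"
  have D: "D > 0" using G K_pos by (simp add: D_def)
  define E where "E = (LINT v|S2. exp (\<alpha> \<bullet> m v))"
  have E: "E \<ge> 0" by (simp add: E_def)
  define C where "C = D\<^sup>2 * E + \<bar>fst u * \<gamma> / 2\<bar> * (norm G)\<^sup>2"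
  have C: "C \<ge> 0" using E by (simp add: C_def)
  have key: "(norm G)\<^sup>2 \<le> t * C" if t: "0 < t" "t * D \<le> 1" for t
  proof -
    let ?\<delta> = "- (t *\<^sub>R G)"
    have "(LINT v|S2. exp (\<alpha> \<bullet> m v) * (exp (?\<delta> \<bullet> m v) - 1 - ?\<delta> \<bullet> m v))
        \<le> (LINT v|S2. exp (\<alpha> \<bullet> m v) * (t * D)\<^sup>2)"
    proof (rule integral_mono[OF integrable_remainder])
      fix v assume "v \<in> space S2"
      then have "\<bar>?\<delta> \<bullet> m v\<bar> \<le> t * D"
        using inner_m_bound[of v ?\<delta>] t by (simp add: space_S2 D_def)
      then have "exp (?\<delta> \<bullet> m v) - 1 - ?\<delta> \<bullet> m v \<le> (?\<delta> \<bullet> m v)\<^sup>2"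
        using t by (intro exp_le_quadratic) linarith
      moreover have "(?\<delta> \<bullet> m v)\<^sup>2 \<le> (t * D)\<^sup>2"
        using power_mono[OF \<open>\<bar>?\<delta> \<bullet> m v\<bar> \<le> t * D\<close>, of 2] by (simp only: power2_abs abs_ge_zero)
      ultimately have "exp (?\<delta> \<bullet> m v) - 1 - ?\<delta> \<bullet> m v \<le> (t * D)\<^sup>2" by linarith
      then show "exp (\<alpha> \<bullet> m v) * (exp (?\<delta> \<bullet> m v) - 1 - ?\<delta> \<bullet> m v) \<le> exp (\<alpha> \<bullet> m v) * (t * D)\<^sup>2"
        by (rule mult_left_mono) simp
    qed (simp add: integrable_exp)
    also have "\<dots> = t\<^sup>2 * (D\<^sup>2 * E)" by (simp add: E_def power_mult_distrib)
    finally have 1: "(LINT v|S2. exp (\<alpha> \<bullet> m v) * (exp (?\<delta> \<bullet> m v) - 1 - ?\<delta> \<bullet> m v)) \<le> t\<^sup>2 * (D\<^sup>2 * E)" .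
    have "(norm (snd ?\<delta>))\<^sup>2 \<le> t\<^sup>2 * (norm G)\<^sup>2"
      using norm_snd_le[of "snd G" "fst G"]
          by (simp add: power_mult_distrib mult_left_mono power_mono)
    then have 2: "fst u * \<gamma> / 2 * (norm (snd ?\<delta>))\<^sup>2 \<le> t\<^sup>2 * (\<bar>fst u * \<gamma> / 2\<bar> * (norm G)\<^sup>2)"
      using mult_mono[OF abs_ge_self[of "fst u * \<gamma> / 2"] , of "(norm (snd ?\<delta>))\<^sup>2" "t\<^sup>2 * (norm G)\<^sup>2"]
      by (simp add: mult_ac)
    have "0 \<le> ?\<delta> \<bullet> G + t\<^sup>2 * (D\<^sup>2 * E) + t\<^sup>2 * (\<bar>fst u * \<gamma> / 2\<bar> * (norm G)\<^sup>2)"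
      using min[of "\<alpha> + ?\<delta>"] 1 2 unfolding phi_expand G_def[symmetric] by linarith
    also have "?\<delta> \<bullet> G = - (t * (norm G)\<^sup>2)" by (simp add: power2_norm_eq_inner)
    finally have "t * (norm G)\<^sup>2 \<le> t * (t * C)" by (simp add: C_def power2_eq_square algebra_simps)
    then show ?thesis using t by simp
  qed
  \<comment> \<open>The first bound keeps the exponents in \<open>[-1, 1]\<close>, the second makes \<open>t * C\<close> smaller than \<open>(norm G)\<^sup>2\<close>.\<close>
  define t where "t = min (1 / D) ((norm G)\<^sup>2 / (2 * (C + 1)))"
  have "t > 0" using D G C by (simp add: t_def)
  moreover have "t * D \<le> 1" using D mult_right_mono[of t "1 / D" D] by (simp add: t_def)
  ultimately have "(norm G)\<^sup>2 \<le> t * C" by (rule key)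
  also have "\<dots> \<le> (norm G)\<^sup>2 / (2 * (C + 1)) * C" using C by (intro mult_right_mono) (auto simp: t_def)
  also have "\<dots> < (norm G)\<^sup>2" using C G by (simp add: divide_simps)
  finally show False by simp
qed

text \<open>
  The remainder in \<open>phi_expand\<close> is nonnegative as \<open>exp x \<ge> 1 + x\<close>.
\<close>

lemma phi_strongly_convex:
  assumes "dual_gradient \<gamma> u \<alpha> = 0"
  shows "phi m \<gamma> u \<alpha> + fst u * \<gamma> / 2 * (norm (snd \<alpha>' - snd \<alpha>))\<^sup>2 \<le> phi m \<gamma> u \<alpha>'"
proof -
  have "0 \<le> (LINT v|S2. exp (\<alpha> \<bullet> m v) * (exp ((\<alpha>' - \<alpha>) \<bullet> m v) - 1 - (\<alpha>' - \<alpha>) \<bullet> m v))"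
    by (intro integral_nonneg_AE AE_I2 mult_nonneg_nonneg exp_ge_zero)
      (metis diff_diff_eq diff_ge_0_iff_ge exp_ge_add_one_self)
  then show ?thesis using phi_expand[of \<gamma> u \<alpha> "\<alpha>' - \<alpha>"] assms by simp
qed

lemma reduced_minimizer:
  assumes \<gamma>: "\<gamma> > 0" and u: "fst u > 0"
  defines "\<beta> \<equiv> beta_opt m \<gamma> (snd u /\<^sub>R fst u)"
  shows "phi m \<gamma> u (theta m \<beta> + ln (fst u) / m0, \<beta>) \<le> phi m \<gamma> u \<alpha>"
proof -
  obtain a b where \<alpha>: "\<alpha> = (a, b)" by (cases \<alpha>)
  define r where "r = m0 * (a - theta m b) - ln (fst u)"
  have a: "a = theta m b + (ln (fst u) + r) / m0" using m0_pos by (simp add: r_def)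
  have "phi m \<gamma> u \<alpha>
      = fst u * phi_hat m \<gamma> (snd u /\<^sub>R fst u) b + fst u / m0 * (exp r - 1 - r - ln (fst u))"
    unfolding \<alpha> using phi_reduced[OF u, of \<gamma> b r] a by simp
  moreover have "phi m \<gamma> u (theta m \<beta> + ln (fst u) / m0, \<beta>)
      = fst u * phi_hat m \<gamma> (snd u /\<^sub>R fst u) \<beta> + fst u / m0 * (exp 0 - 1 - 0 - ln (fst u))"
    using phi_reduced[OF u, of \<gamma> \<beta> 0] by simp
  moreover have "fst u * phi_hat m \<gamma> (snd u /\<^sub>R fst u) \<beta> \<le> fst u * phi_hat m \<gamma> (snd u /\<^sub>R fst u) b"
    using u beta_opt_minimizes[OF \<gamma>] unfolding \<beta>_def by (intro mult_left_mono) auto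
  moreover have "fst u / m0 * (exp 0 - 1 - 0 - ln (fst u))
      \<le> fst u / m0 * (exp r - 1 - r - ln (fst u))"
    using u m0_pos exp_ge_add_one_self[of r]
        by (intro mult_left_mono) (simp_all del: exp_ge_add_one_self)
  ultimately show ?thesis by linarith
qed

lemma alpha_opt_minimizes:
  assumes "\<gamma> > 0" "fst u > 0"
  shows "phi m \<gamma> u (alpha_opt m \<gamma> u) \<le> phi m \<gamma> u \<alpha>"
  unfolding alpha_opt_def 
  by (rule arg_min_minimizes[where f = "phi m \<gamma> u", OF reduced_minimizer[OF assms]])

text \<open>
  Strong convexity makes the second component of a minimizer unique; in the zeroth one,
  equality of the minimal values forces \<open>exp r = 1 + r\<close> in \<open>phi_reduced\<close>.
\<close>

lemma alpha_opt_eq: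
  assumes \<gamma>: "\<gamma> > 0" and u: "fst u > 0"
  defines "\<beta> \<equiv> beta_opt m \<gamma> (snd u /\<^sub>R fst u)"
  shows "alpha_opt m \<gamma> u = (theta m \<beta> + ln (fst u) / m0, \<beta>)" (is "_ = ?\<alpha>")
proof -
  obtain a b where ab: "alpha_opt m \<gamma> u = (a, b)" by (cases "alpha_opt m \<gamma> u")
  have min: "phi m \<gamma> u ?\<alpha> \<le> phi m \<gamma> u \<alpha>'" for \<alpha>'
    unfolding \<beta>_def by (rule reduced_minimizer[OF \<gamma> u])
  have eq: "phi m \<gamma> u (a, b) = phi m \<gamma> u ?\<alpha>"
    using alpha_opt_minimizes[OF \<gamma> u, of ?\<alpha>] min[of "(a, b)"] ab by simp
  have "fst u * \<gamma> / 2 * (norm (b - \<beta>))\<^sup>2 \<le> 0"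
    using phi_strongly_convex[OF dual_gradient_eq_0[OF min], of "(a, b)"] eq by simp
  then have "(norm (b - \<beta>))\<^sup>2 \<le> 0" using \<gamma> u by (simp add: mult_le_0_iff)
  then have b: "b = \<beta>" by simp
  define r where "r = m0 * (a - theta m b) - ln (fst u)"
  have a: "a = theta m b + (ln (fst u) + r) / m0" using m0_pos by (simp add: r_def)
  have "fst u / m0 * (exp r - 1 - r - ln (fst u)) = fst u / m0 * (exp 0 - 1 - 0 - ln (fst u))"
    using eq phi_reduced[OF u, of \<gamma> b r] phi_reduced[OF u, of \<gamma> b 0] a b by simp
  moreover have "fst u / m0 \<noteq> 0" using u m0_pos by simp
  ultimately have "exp r - 1 - r - ln (fst u) = exp 0 - 1 - 0 - ln (fst u)"
    by (metis mult_left_cancel)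
  then have "exp r - 1 = r" by simp
  then have "exp r = 1" using ln_eq_minus_one[of "exp r"] by simp
  then show ?thesis using ab a b by simp
qed

text \<open>
  The first-order condition for the dual problem.
\<close>

lemma moments_alpha_opt:
  assumes "\<gamma> > 0" "fst u > 0"
  shows "moments m (ansatz m (alpha_opt m \<gamma> u)) = u - (fst u * \<gamma>) *\<^sub>R (0, snd (alpha_opt m \<gamma> u))"
proof -
  define k where "k = (fst u * \<gamma>) *\<^sub>R (0::real, snd (alpha_opt m \<gamma> u))"
  have "dual_gradient \<gamma> u (alpha_opt m \<gamma> u) = 0"
    by (rule dual_gradient_eq_0[OF alpha_opt_minimizes[OF assms]])
  then have 0: "moments m (ansatz m (alpha_opt m \<gamma> u)) - u + k = 0"
    by (simp only: dual_gradient_def k_def)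
  have "moments m (ansatz m (alpha_opt m \<gamma> u))
      = (moments m (ansatz m (alpha_opt m \<gamma> u)) - u + k) + (u - k)" by simp
  also have "\<dots> = u - k" unfolding 0 by simp
  finally have "moments m (ansatz m (alpha_opt m \<gamma> u)) = u - k" .
  then show ?thesis by (simp only: k_def)
qed

section \<open>Strong duality and the gradient of the entropy\<close>

text \<open>
  The integrated Fenchel inequality bounds the entropy term below, and completing the square
  bounds the penalty term below; the multiplier's pairing with the unknown moments cancels.
\<close>

lemma weak_duality:
  assumes \<gamma>: "\<gamma> > 0" and u: "fst u > 0" and g: "g \<in> feasible_densities m u"
  shows "- phi m \<gamma> u \<alpha> \<le> (LINT v|S2. g v * ln (g v) - g v) +
        1 / (2 * fst u * \<gamma>) * (norm ((LINT v|S2. g v *\<^sub>R snd (m v)) - snd u))\<^sup>2"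
proof -
  from g have int: "integrable S2 (\<lambda>v. g v *\<^sub>R m v)" "integrable S2 (\<lambda>v. g v * ln (g v) - g v)"
    and pos: "\<And>v. v \<in> sphere 0 1 \<Longrightarrow> 0 \<le> g v" and mass: "fst u = (LINT v|S2. fst (m v) * g v)"
    by (auto simp: feasible_densities_def)
  define y where "y = (LINT v|S2. g v *\<^sub>R snd (m v))"
  have "fst (LINT v|S2. g v *\<^sub>R m v) = fst u" "snd (LINT v|S2. g v *\<^sub>R m v) = y"
    using integral_bounded_linear[OF bounded_linear_fst int(1)] integral_bounded_linear[OF
        bounded_linear_snd int(1)]
    by (simp_all add: mass y_def mult.commute)
  then have M: "(LINT v|S2. g v * (\<alpha> \<bullet> m v)) = fst \<alpha> * fst u + snd \<alpha> \<bullet> y"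
    using integral_inner_right[of \<alpha> S2 "\<lambda>v. g v *\<^sub>R m v"] int(1)
    by (simp add: inner_prod_def[of \<alpha> "LINT v|S2. g v *\<^sub>R m v"])
  have i: "integrable S2 (\<lambda>v. g v * (\<alpha> \<bullet> m v))"
    using integrable_inner_right[of \<alpha> S2 "\<lambda>v. g v *\<^sub>R m v"] int(1) by simp
  have "(LINT v|S2. g v * (\<alpha> \<bullet> m v) - exp (\<alpha> \<bullet> m v)) \<le> (LINT v|S2. g v * ln (g v) - g v)"
    by (rule integral_mono) (use i integrable_exp int(2) pos in \<open>auto simp: space_S2 intro!:
        fenchel_young_entropy\<close>)
  then have 1: "fst \<alpha> * fst u + snd \<alpha> \<bullet> y - (LINT v|S2. exp (\<alpha> \<bullet> m v))
      \<le> (LINT v|S2. g v * ln (g v) - g v)"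
    using i integrable_exp by (simp add: M)
  define k where "k = fst u * \<gamma>"
  have k: "k > 0" using \<gamma> u by (simp add: k_def)
  \<comment> \<open>Half the squared norm of \<open>d + k *\<^sub>R b\<close>, divided by \<open>k\<close>.\<close>
  have square: "0 \<le> (norm d)\<^sup>2 / (2 * k) + b \<bullet> d + k / 2 * (norm b)\<^sup>2" for b d :: "real^'n"
  proof -
    have "(norm (d + k *\<^sub>R b))\<^sup>2 = (norm d)\<^sup>2 + 2 * k * (b \<bullet> d) + k\<^sup>2 * (norm b)\<^sup>2"
      unfolding power2_norm_eq_inner
      by (simp add: inner_add_left inner_add_right inner_commute power2_eq_square)
    then have "(norm (d + k *\<^sub>R b))\<^sup>2 / (2 * k) = (norm d)\<^sup>2 / (2 * k) + b \<bullet> d + k / 2 * (norm b)\<^sup>2"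
      using k by (simp add: add_divide_distrib power2_eq_square)
    then show ?thesis using k by (metis divide_nonneg_pos mult_pos_pos zero_le_power2
        zero_less_numeral)
  qed
  from square[of "y - snd u" "snd \<alpha>"] have "snd \<alpha> \<bullet> snd u - k / 2 * (norm (snd \<alpha>))\<^sup>2
      \<le> snd \<alpha> \<bullet> y + 1 / (2 * k) * (norm (y - snd u))\<^sup>2"
    by (simp add: inner_diff_right)
  then show ?thesis
    using 1 unfolding phi_def y_def[symmetric] k_def by (simp add: inner_prod_def mult.assoc)
qed

lemma ansatz_feasible:
  assumes "\<gamma> > 0" "fst u > 0"
  shows "ansatz m (alpha_opt m \<gamma> u) \<in> feasible_densities m u"
proof -
  let ?\<alpha> = "alpha_opt m \<gamma> u"
  have "fst (moments m (ansatz m ?\<alpha>)) = (LINT v|S2. fst (m v) * ansatz m ?\<alpha> v)"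
    using integral_bounded_linear[OF bounded_linear_fst integrable_exp_m[of ?\<alpha>]]
        by (simp add: moments_def ansatz_def mult.commute)
  then have "fst u = (LINT v|S2. fst (m v) * ansatz m ?\<alpha> v)"
    using moments_alpha_opt[OF assms] by simp
  moreover have "integrable S2 (\<lambda>v. exp (?\<alpha> \<bullet> m v) * (?\<alpha> \<bullet> m v))"
    using integrable_inner_right[of ?\<alpha> S2 "\<lambda>v. exp (?\<alpha> \<bullet> m v) *\<^sub>R m v"] integrable_exp_m by simp
  moreover have "ansatz m ?\<alpha> \<in> borel_measurable S2" unfolding ansatz_def by measurable
  ultimately show ?thesis
    using integrable_exp[of ?\<alpha>] integrable_exp_m[of ?\<alpha>]
    unfolding feasible_densities_def by (simp add: ansatz_def[abs_def])
qed

text \<open>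
  The ansatz density of the multiplier is feasible, and both inequalities behind
  \<open>weak_duality\<close> are equalities for it: the Fenchel one because its logarithm is \<open>\<alpha> \<bullet> m v\<close>,
  the completed square by \<open>moments_alpha_opt\<close>.
\<close>

lemma strong_duality:
  assumes \<gamma>: "\<gamma> > 0" and u: "fst u > 0"
  shows "entropy m \<gamma> u = - phi m \<gamma> u (alpha_opt m \<gamma> u)"
proof -
  define \<alpha> where "\<alpha> = alpha_opt m \<gamma> u"
  let ?g = "ansatz m \<alpha>"
  let ?J = "\<lambda>g. (LINT v|S2. g v * ln (g v) - g v) +
        1 / (2 * fst u * \<gamma>) * (norm ((LINT v|S2. g v *\<^sub>R snd (m v)) - snd u))\<^sup>2"
  have feas: "?g \<in> feasible_densities m u" unfolding \<alpha>_def by (rule ansatz_feasible[OF \<gamma> u])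
  define k where "k = fst u * \<gamma>"
  have k: "k > 0" using \<gamma> u by (simp add: k_def)
  have mom: "moments m ?g = u - k *\<^sub>R (0, snd \<alpha>)" unfolding \<alpha>_def k_def
      by (rule moments_alpha_opt[OF \<gamma> u])
  have "(LINT v|S2. ?g v *\<^sub>R snd (m v)) = snd (moments m ?g)"
    using integral_bounded_linear[OF bounded_linear_snd integrable_exp_m[of \<alpha>]]
        by (simp add: moments_def ansatz_def)
  then have 1: "(LINT v|S2. ?g v *\<^sub>R snd (m v)) - snd u = - (k *\<^sub>R snd \<alpha>)" by (simp add: mom)
  have i: "integrable S2 (\<lambda>v. exp (\<alpha> \<bullet> m v) * (\<alpha> \<bullet> m v))"
    using integrable_inner_right[of \<alpha> S2 "\<lambda>v. exp (\<alpha> \<bullet> m v) *\<^sub>R m v"] integrable_exp_m by simp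
  have "(LINT v|S2. ?g v * ln (?g v) - ?g v) = \<alpha> \<bullet> moments m ?g - (LINT v|S2. exp (\<alpha> \<bullet> m v))"
    using i integrable_exp by (simp add: inner_moments ansatz_def)
  also have "\<alpha> \<bullet> moments m ?g = \<alpha> \<bullet> u - k * (norm (snd \<alpha>))\<^sup>2"
    unfolding mom by (simp add: inner_diff_right inner_prod_def power2_norm_eq_inner)
  finally have "?J ?g = \<alpha> \<bullet> u - k * (norm (snd \<alpha>))\<^sup>2 - (LINT v|S2. exp (\<alpha> \<bullet> m v))
      + 1 / (2 * k) * (norm (k *\<^sub>R snd \<alpha>))\<^sup>2"
    unfolding 1 by (simp add: k_def mult.assoc)
  also have "1 / (2 * k) * (norm (k *\<^sub>R snd \<alpha>))\<^sup>2 = k / 2 * (norm (snd \<alpha>))\<^sup>2"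
    using k by (simp add: power_mult_distrib power2_eq_square)
  finally have J: "?J ?g = - phi m \<gamma> u \<alpha>" by (simp add: phi_def k_def)
  have "(INF g\<in>feasible_densities m u. ?J g) = ?J ?g"
  proof (rule cInf_eq_minimum)
    show "?J ?g \<in> ?J ` feasible_densities m u" using feas by (rule imageI)
    show "?J ?g \<le> x" if "x \<in> ?J ` feasible_densities m u" for x
    proof -
      from that obtain g where "x = ?J g" "g \<in> feasible_densities m u" by (elim imageE)
      then show ?thesis using weak_duality[OF \<gamma> u, of g \<alpha>] J by simp
    qed
  qed
  then show ?thesis unfolding entropy_def J by (simp add: \<alpha>_def)
qed

text \<open>
  Each of the two minimizers is inserted in the strong convexity inequality of the other
  problem. In the sum the values of \<open>phi_hat\<close> cancel except for the linear terms \<open>\<beta> \<bullet> w\<close>.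
\<close>

lemma beta_opt_lipschitz:
  assumes \<gamma>: "\<gamma> > 0"
  shows "norm (beta_opt m \<gamma> w' - beta_opt m \<gamma> w) \<le> norm (w' - w) / \<gamma>"
proof -
  let ?b = "beta_opt m \<gamma> w" and ?b' = "beta_opt m \<gamma> w'"
  have str: "phi_hat m \<gamma> w (beta_opt m \<gamma> w) + \<gamma> / 2 * (norm (\<beta>' - beta_opt m \<gamma> w))\<^sup>2
      \<le> phi_hat m \<gamma> w \<beta>'" for w \<beta>'
  proof -
    have "phi m \<gamma> (1, w) (theta m (beta_opt m \<gamma> w), beta_opt m \<gamma> w) \<le> phi m \<gamma> (1, w) \<alpha>" for \<alpha>
      using reduced_minimizer[OF \<gamma>, of "(1, w)"] by simp
    from phi_strongly_convex[OF dual_gradient_eq_0[OF this], of "(theta m \<beta>', \<beta>')"]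
    show ?thesis by (simp add: phi_hat_def)
  qed
  have "\<gamma> * (norm (?b' - ?b))\<^sup>2 \<le> (?b' - ?b) \<bullet> (w' - w)"
    using str[of w ?b'] str[of w' ?b] unfolding phi_hat_theta
    by (simp add: norm_minus_commute inner_diff_left inner_diff_right algebra_simps)
  also have "\<dots> \<le> norm (?b' - ?b) * norm (w' - w)" by (rule norm_cauchy_schwarz)
  finally have "norm (?b' - ?b) * (\<gamma> * norm (?b' - ?b)) \<le> norm (?b' - ?b) * norm (w' - w)"
    by (simp add: power2_eq_square mult_ac)
  then have "\<gamma> * norm (?b' - ?b) \<le> norm (w' - w)"
    by (cases "?b' = ?b") auto
  then show ?thesis using \<gamma> by (simp add: field_simps)
qed

lemma isCont_alpha_opt:
  assumes \<gamma>: "\<gamma> > 0" and u: "fst u > 0"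
  shows "isCont (alpha_opt m \<gamma>) u"
proof -
  have cb: "isCont (beta_opt m \<gamma>) w" for w
  proof -
    have "continuous_on UNIV (beta_opt m \<gamma>)"
      by (rule lipschitz_on_continuous_on[of "1 / \<gamma>"])
        (use beta_opt_lipschitz[OF \<gamma>] \<gamma> in \<open>auto intro!: lipschitz_onI simp: dist_norm\<close>)
    then show ?thesis by (simp add: continuous_on_eq_continuous_at)
  qed
  have ct: "isCont (theta m) \<beta>" for \<beta>
  proof -
    have "continuous_on UNIV (theta m)"
      by (rule lipschitz_on_continuous_on[of "K / m0"])
        (use theta_lipschitz K_pos m0_pos in \<open>auto intro!: lipschitz_onI simp: dist_norm\<close>)
    then show ?thesis by (simp add: continuous_on_eq_continuous_at)
  qed
  have w: "((\<lambda>u. beta_opt m \<gamma> (snd u /\<^sub>R fst u)) \<longlongrightarrow> beta_opt m \<gamma> (snd u /\<^sub>R fst u)) (at u)"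
    using u by (intro isCont_tendsto_compose[OF cb] tendsto_intros) auto
  have "((\<lambda>u. (theta m (beta_opt m \<gamma> (snd u /\<^sub>R fst u))
      + ln (fst u) / m0, beta_opt m \<gamma> (snd u /\<^sub>R fst u)))
      \<longlongrightarrow> alpha_opt m \<gamma> u) (at u)"
    unfolding alpha_opt_eq[OF \<gamma> u] using u m0_pos
    by (intro tendsto_intros isCont_tendsto_compose[OF ct] w) auto
  moreover have "\<forall>\<^sub>F u in at u. fst u > 0"
    by (rule order_tendstoD(1)[OF _ u]) (intro tendsto_intros)
  then have "\<forall>\<^sub>F u in at u. (theta m (beta_opt m \<gamma> (snd u /\<^sub>R fst u))
      + ln (fst u) / m0, beta_opt m \<gamma> (snd u /\<^sub>R fst u)) = alpha_opt m \<gamma> u"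
    by eventually_elim (simp add: alpha_opt_eq[OF \<gamma>])
  ultimately show ?thesis
    unfolding isCont_def by (rule Lim_transform_eventually)
qed

text \<open>
  Envelope argument. With \<open>D u\<close> denoting the claimed gradient, the increment of the entropy
  from \<open>u\<close> to \<open>y\<close> lies between \<open>(y - u) \<bullet> D u\<close> and \<open>(y - u) \<bullet> D y\<close>, and \<open>D\<close> is continuous.
\<close>

lemma entropy_GDERIV:
  assumes \<gamma>: "\<gamma> > 0" and u: "fst u > 0"
  shows "GDERIV (entropy m \<gamma>) u :> alpha_opt m \<gamma> u - (\<gamma> / 2 * (norm (snd (alpha_opt m \<gamma> u)))\<^sup>2, 0)"
proof -
  define D where "D u = alpha_opt m \<gamma> u - (\<gamma> / 2 * (norm (snd (alpha_opt m \<gamma> u)))\<^sup>2, 0)" for u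
  have sub: "(x - y) \<bullet> D y \<le> entropy m \<gamma> x - entropy m \<gamma> y" if "fst x > 0" "fst y > 0" for x y
  proof -
    have "phi m \<gamma> x (alpha_opt m \<gamma> x) \<le> phi m \<gamma> x (alpha_opt m \<gamma> y)"
      using alpha_opt_minimizes[OF \<gamma>] that by blast
    moreover have "phi m \<gamma> x \<alpha> = phi m \<gamma> y \<alpha> - (x - y) \<bullet> (\<alpha> - (\<gamma> / 2 * (norm (snd \<alpha>))\<^sup>2, 0))" for \<alpha>
      by (simp add: phi_def inner_prod_def inner_diff_left inner_diff_right inner_commute)
          (simp add: field_simps)
    from this[of "alpha_opt m \<gamma> y"] have "phi m \<gamma> x (alpha_opt m \<gamma> y)
        = phi m \<gamma> y (alpha_opt m \<gamma> y) - (x - y) \<bullet> D y"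
      by (simp only: D_def)
    ultimately show ?thesis
      unfolding strong_duality[OF \<gamma> that(1)] strong_duality[OF \<gamma> that(2)] by linarith
  qed
  have cont: "(D \<longlongrightarrow> D u) (at u)"
    unfolding D_def using isCont_alpha_opt[OF \<gamma> u] unfolding isCont_def by (intro tendsto_intros)
  have "((\<lambda>y. norm (entropy m \<gamma> y - entropy m \<gamma> u - (y - u) \<bullet> D u) / norm (y - u)) \<longlongrightarrow> 0) (at u)"
  proof (rule Lim_null_comparison)
    show "((\<lambda>y. norm (D y - D u)) \<longlongrightarrow> 0) (at u)"
      using cont by (simp add: LIM_zero tendsto_norm_zero)
    have "\<forall>\<^sub>F y in at u. fst y > 0"
      by (rule order_tendstoD(1)[OF _ u]) (intro tendsto_intros)
    then show "\<forall>\<^sub>F y in at u. norm (norm (entropy m \<gamma> y - entropy m \<gamma> u - (y - u) \<bullet> D u) / norm (y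
        - u)) \<le> norm (D y - D u)"
    proof eventually_elim
      case (elim y)
      have "(y - u) \<bullet> D u \<le> entropy m \<gamma> y - entropy m \<gamma> u" by (rule sub[OF elim u])
      moreover have "entropy m \<gamma> y - entropy m \<gamma> u \<le> (y - u) \<bullet> D y"
        using sub[OF u elim] by (simp add: inner_diff_left)
      ultimately have "\<bar>entropy m \<gamma> y - entropy m \<gamma> u - (y - u) \<bullet> D u\<bar> \<le> (y - u) \<bullet> (D y - D u)"
        by (simp add: inner_diff_right)
      also have "\<dots> \<le> norm (y - u) * norm (D y - D u)" by (rule norm_cauchy_schwarz)
      finally show ?case by (cases "y = u") (auto simp: field_simps)
    qed
  qed
  then show ?thesis
    unfolding gderiv_def has_derivative_iff_norm D_def[symmetric]
        by (simp add: bounded_linear_inner_left)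
qed

lemma entropy_grad_eq:
  assumes "\<gamma> > 0" "fst u > 0"
  shows "entropy_grad m \<gamma> u = alpha_opt m \<gamma> u - (\<gamma> / 2 * (norm (snd (alpha_opt m \<gamma> u)))\<^sup>2, 0)"
  unfolding entropy_grad_def
proof (rule the_equality)
  show "GDERIV (entropy m \<gamma>) u :> alpha_opt m \<gamma> u - (\<gamma> / 2 * (norm (snd (alpha_opt m \<gamma> u)))\<^sup>2, 0)"
    by (rule entropy_GDERIV[OF assms])
  fix D assume "GDERIV (entropy m \<gamma>) u :> D"
  then have "(\<lambda>h. h \<bullet> D)
      = (\<lambda>h. h \<bullet> (alpha_opt m \<gamma> u - (\<gamma> / 2 * (norm (snd (alpha_opt m \<gamma> u)))\<^sup>2, 0)))"
    using entropy_GDERIV[OF assms] unfolding gderiv_def by (rule has_derivative_unique)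
  then show "D = alpha_opt m \<gamma> u - (\<gamma> / 2 * (norm (snd (alpha_opt m \<gamma> u)))\<^sup>2, 0)"
    by (metis vector_eq_ldot)
qed

lemma u_tilde_eq:
  assumes "\<gamma> > 0" "fst u > 0"
  shows "u_tilde m \<gamma> u = u - (fst u * \<gamma>) *\<^sub>R (0, beta_opt m \<gamma> (snd u /\<^sub>R fst u))"
  unfolding u_tilde_def moments_alpha_opt[OF assms] by (simp add: alpha_opt_eq[OF assms])

text \<open>
  The gradient of the entropy differs from the multiplier only in the zeroth entry, that is,
  the exponent differs by a constant on the sphere.
\<close>

lemma u_gamma_eq:
  assumes "\<gamma> > 0" "fst u > 0"
  shows "u_gamma m \<gamma> u
      = exp (- (m0 * \<gamma> / 2 * (norm (beta_opt m \<gamma> (snd u /\<^sub>R fst u)))\<^sup>2)) *\<^sub>R u_tilde m \<gamma> u"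
proof -
  let ?b = "beta_opt m \<gamma> (snd u /\<^sub>R fst u)" and ?\<alpha> = "alpha_opt m \<gamma> u"
  have "u_gamma m \<gamma> u = (LINT v|S2. exp (- (m0 * \<gamma> / 2 * (norm ?b)\<^sup>2)) *\<^sub>R (exp (?\<alpha> \<bullet> m v) *\<^sub>R m v))"
    unfolding u_gamma_def moments_def ansatz_def entropy_grad_eq[OF assms]
    by (rule integral_S2_cong)
      (simp add: alpha_opt_eq[OF assms] inner_diff_left inner_prod_def fst_m0 algebra_simps
          flip: exp_add)
  also have "\<dots> = exp (- (m0 * \<gamma> / 2 * (norm ?b)\<^sup>2)) *\<^sub>R u_tilde m \<gamma> u"
    unfolding u_tilde_def moments_def ansatz_def by (rule integral_scaleR_right)
  finally show ?thesis .
qed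

text \<open>
  The factor \<open>fst u * sqrt area_S2\<close> is the integral of the density, which is known from the
  zeroth moment.
\<close>

lemma norm_u_tilde_le:
  assumes "\<gamma> > 0" "fst u > 0"
  shows "norm (u_tilde m \<gamma> u) \<le> fst u * (K * sqrt area_S2)"
proof -
  let ?\<alpha> = "alpha_opt m \<gamma> u"
  have "fst u = (LINT v|S2. fst (m v) * ansatz m ?\<alpha> v)"
    using ansatz_feasible[OF assms] by (simp add: feasible_densities_def)
  also have "\<dots> = (LINT v|S2. m0 * exp (?\<alpha> \<bullet> m v))"
    by (rule integral_S2_cong) (simp add: fst_m0 ansatz_def)
  finally have mass: "(LINT v|S2. exp (?\<alpha> \<bullet> m v)) = fst u * sqrt area_S2"
    using m0_pos by (simp add: m0_def field_simps)
  have "norm (u_tilde m \<gamma> u) \<le> (LINT v|S2. norm (exp (?\<alpha> \<bullet> m v) *\<^sub>R m v))"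
    unfolding u_tilde_def moments_def ansatz_def by (rule integral_norm_bound)
  also have "\<dots> \<le> (LINT v|S2. exp (?\<alpha> \<bullet> m v) * K)"
  proof (rule integral_mono)
    show "integrable S2 (\<lambda>v. norm (exp (?\<alpha> \<bullet> m v) *\<^sub>R m v))"
      by (rule integrable_norm[OF integrable_exp_m])
  qed (use integrable_exp[of ?\<alpha>] m_bound in \<open>auto simp: space_S2\<close>)
  also have "\<dots> = fst u * (K * sqrt area_S2)" by (simp add: mass)
  finally show ?thesis .
qed

end

section \<open>Accuracy of the two ansatz densities\<close>

lemma spherical_harmonic_measurable:
  assumes "spherical_harmonic l Y"
  shows "Y \<in> borel_measurable S2"
proof -
  obtain p where p: "real_polynomial_function p" "\<And>v. v \<in> sphere 0 1 \<Longrightarrow> Y v = p v"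
    using assms unfolding spherical_harmonic_def by blast
  have "continuous_on (sphere 0 1) p"
    using p(1) continuous_real_polymonial_function continuous_at_imp_continuous_on by blast
  then have "continuous_on (sphere 0 1) Y"
    by (rule continuous_on_eq) (simp add: p(2))
  then show ?thesis by (rule borel_measurable_S2I)
qed

text \<open>
  The blocks \<open>l\<^sup>2 \<le> i < (l + 1)\<^sup>2\<close> with \<open>l \<le> N\<close> exhaust the indices below \<open>(N + 1)\<^sup>2\<close>.
\<close>

lemma real_spherical_harmonics_measurable:
  assumes Y: "real_spherical_harmonics N Y" and i: "i < (N + 1)\<^sup>2"
  shows "Y i \<in> borel_measurable S2"
proof -
  have "\<exists>l\<le>M. i \<in> {l\<^sup>2..<(l + 1)\<^sup>2}" if "i < (M + 1)\<^sup>2" for M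
    using that
  proof (induction M)
    case (Suc M)
    then show ?case
      by (cases "i < (M + 1)\<^sup>2") (auto intro: le_SucI)
  qed simp
  then obtain l where "l \<le> N" "i \<in> {l\<^sup>2..<(l + 1)\<^sup>2}" using i by blast
  then have "spherical_harmonic l (Y i)" using Y unfolding real_spherical_harmonics_def by blast
  then show ?thesis by (rule spherical_harmonic_measurable)
qed

lemma harmonics_vector_measurable:
  fixes idx :: "'n::finite \<Rightarrow> nat"
  assumes Y: "real_spherical_harmonics N Y" and idx: "\<And>k. idx k < (N + 1)\<^sup>2"
  shows "harmonics_vector Y idx \<in> borel_measurable S2"
proof -
  have [measurable]: "Y 0 \<in> borel_measurable S2" "\<And>k. Y (idx k) \<in> borel_measurable S2"
    using real_spherical_harmonics_measurable[OF Y] idx by auto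
  have "(\<lambda>v. \<chi> k. Y (idx k) v) \<in> borel_measurable S2"
    by (subst borel_measurable_euclidean_space)
      (auto simp: Basis_vec_def inner_axis)
  then show ?thesis
    unfolding harmonics_vector_def[abs_def] by (intro borel_measurable_Pair) auto
qed

theorem theorem4:
  fixes N :: nat
    and Y :: "nat \<Rightarrow> real^3 \<Rightarrow> real"
    and idx :: "'n::finite \<Rightarrow> nat"
    and m :: "real^3 \<Rightarrow> real \<times> (real^'n)"
    and n :: nat
    and \<gamma> :: real
    and u :: "real \<times> (real^'n)"
    and \<beta> :: "real^'n"
  assumes "N \<ge> 1"
    and "n + 1 = (N + 1)\<^sup>2"
    and "real_spherical_harmonics N Y"
    and "bij_betw idx UNIV {1..n}"
    and "m = harmonics_vector Y idx"
    and "\<gamma> > 0"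
    and "fst u > 0"
    and "\<beta> = beta_opt m \<gamma> (snd u /\<^sub>R fst u)"
  shows "u_tilde m \<gamma> u = u - (fst u * \<gamma>) *\<^sub>R (0, \<beta>) \<and>
    (\<forall>M>0. norm \<beta> < M \<longrightarrow>
       norm (u_tilde m \<gamma> u - u) = fst u * \<gamma> * norm \<beta> \<and>
       fst u * \<gamma> * norm \<beta> \<le> fst u * \<gamma> * M \<and>
       norm (u_gamma m \<gamma> u - u) \<le>
         fst u * \<gamma> * M + (1 - exp (- (\<gamma> / 2) * M\<^sup>2)) * norm (u_tilde m \<gamma> u) \<and>
       fst u * \<gamma> * M + (1 - exp (- (\<gamma> / 2) * M\<^sup>2)) * norm (u_tilde m \<gamma> u) \<le>
         fst u * (\<gamma> * M + real (n + 1) * sqrt (real (n + 1) / area_S2) *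
                            (1 - exp (- (\<gamma> / 2) * M\<^sup>2))))"
proof -
  note N = assms(1) and n = assms(2) and Y = assms(3) and idx = assms(4) and m = assms(5)
    and \<gamma> = assms(6) and u = assms(7) and \<beta> = assms(8)
  have A: "area_S2 > 0" by (simp add: area_S2_eq)
  define K where "K = sqrt (real (n + 1) ^ 3) / area_S2"
  interpret moment_map m K
  proof
    have "idx k < (N + 1)\<^sup>2" for k
      using bij_betwE[OF idx] n[symmetric] by (auto simp: less_Suc_eq_le)
    then show "m \<in> borel_measurable S2" unfolding m by (rule harmonics_vector_measurable[OF Y])
    show "norm (m v) \<le> K" if "v \<in> sphere 0 1" for v
      unfolding m K_def using norm_harmonics_vector_le[OF Y idx n N] that by simp
    show "fst (m v) = 1 / sqrt area_S2" if "v \<in> sphere 0 1" for v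
      using Y that unfolding m real_spherical_harmonics_def by (simp add: harmonics_vector_def)
  qed
  have ut: "u_tilde m \<gamma> u = u - (fst u * \<gamma>) *\<^sub>R (0, \<beta>)"
    unfolding \<beta> by (rule u_tilde_eq[OF \<gamma> u])
  have dist: "norm (u_tilde m \<gamma> u - u) = fst u * \<gamma> * norm \<beta>"
    unfolding ut using \<gamma> u by (simp add: norm_Pair abs_mult)
  have m0_le: "m0 \<le> 1"
  proof -
    have "1 \<le> sqrt area_S2" using pi_gt3 by (simp add: area_S2_eq)
    then show ?thesis by (simp add: m0_def)
  qed
  define e where "e = exp (- (m0 * \<gamma> / 2 * (norm \<beta>)\<^sup>2))"
  have ug: "u_gamma m \<gamma> u = e *\<^sub>R u_tilde m \<gamma> u"
    unfolding e_def \<beta> by (rule u_gamma_eq[OF \<gamma> u])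
  have e1: "e \<le> 1" using m0_pos \<gamma> by (simp add: e_def)
  have bound: "norm (u_tilde m \<gamma> u) \<le> fst u * (real (n + 1) * sqrt (real (n + 1) / area_S2))"
  proof -
    have "sqrt (real (n + 1) ^ 3) = real (n + 1) * sqrt (real (n + 1))"
      by (simp add: power3_eq_cube real_sqrt_mult)
    moreover have "area_S2 = sqrt area_S2 * sqrt area_S2" using A by simp
    ultimately have "K * sqrt area_S2 = real (n + 1) * sqrt (real (n + 1) / area_S2)"
      unfolding K_def real_sqrt_divide using A by (simp add: field_simps)
    then show ?thesis using norm_u_tilde_le[OF \<gamma> u] by simp
  qed
  show ?thesis
  proof (intro conjI allI impI)
    show "u_tilde m \<gamma> u = u - (fst u * \<gamma>) *\<^sub>R (0, \<beta>)" by (rule ut)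
  next
    fix M assume M: "M > 0" "norm \<beta> < M"
    show "norm (u_tilde m \<gamma> u - u) = fst u * \<gamma> * norm \<beta>" by (rule dist)
    show le: "fst u * \<gamma> * norm \<beta> \<le> fst u * \<gamma> * M"
      using M \<gamma> u by (intro mult_left_mono) auto
    define E where "E = exp (- (\<gamma> / 2) * M\<^sup>2)"
    have E1: "E \<le> 1" using \<gamma> by (simp add: E_def)
    \<comment> \<open>This is where \<open>m0 \<le> 1\<close> permits to drop \<open>m0\<close> from the exponent.\<close>
    have "E \<le> e"
    proof -
      have "m0 * (norm \<beta>)\<^sup>2 \<le> 1 * M\<^sup>2"
        using M m0_le m0_pos by (intro mult_mono power_mono) auto
      then have "\<gamma> / 2 * (m0 * (norm \<beta>)\<^sup>2) \<le> \<gamma> / 2 * M\<^sup>2" using \<gamma> by (intro mult_left_mono) auto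
      then show ?thesis by (simp add: E_def e_def mult_ac)
    qed
    have "u_gamma m \<gamma> u - u = (u_tilde m \<gamma> u - u) - (1 - e) *\<^sub>R u_tilde m \<gamma> u"
      by (simp add: ug scaleR_left_diff_distrib)
    then have "norm (u_gamma m \<gamma> u - u) \<le> norm (u_tilde m \<gamma> u - u) + norm ((1 - e) *\<^sub>R u_tilde m \<gamma> u)"
      by (metis norm_triangle_ineq4)
    also have "norm ((1 - e) *\<^sub>R u_tilde m \<gamma> u) = (1 - e) * norm (u_tilde m \<gamma> u)" using e1 by simp
    also have "norm (u_tilde m \<gamma> u - u) + (1 - e) * norm (u_tilde m \<gamma> u)
        \<le> fst u * \<gamma> * M + (1 - E) * norm (u_tilde m \<gamma> u)"
      unfolding dist using le \<open>E \<le> e\<close> by (intro add_mono mult_right_mono) auto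
    finally show "norm (u_gamma m \<gamma> u - u)
        \<le> fst u * \<gamma> * M + (1 - exp (- (\<gamma> / 2) * M\<^sup>2)) * norm (u_tilde m \<gamma> u)"
      by (simp only: E_def)
    have "(1 - E) * norm (u_tilde m \<gamma> u)
        \<le> (1 - E) * (fst u * (real (n + 1) * sqrt (real (n + 1) / area_S2)))"
      using bound E1 by (intro mult_left_mono) auto
    then show "fst u * \<gamma> * M + (1 - exp (- (\<gamma> / 2) * M\<^sup>2)) * norm (u_tilde m \<gamma> u) \<le>
         fst u * (\<gamma> * M + real (n + 1) * sqrt (real (n + 1) / area_S2) * (1 - exp (- (\<gamma> / 2) * M\<^sup>2)))"
      unfolding E_def[symmetric]
          by (simp only: distrib_left mult.assoc mult.left_commute mult.commute add_left_mono)
  qed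
qed

end
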